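(* Let $X$ and $Y$ be compact metric spaces, let $Z$ be an ordered compact metric space with order $\le$, and let $\varphi_i:X\to Z$ and $\psi_i:Y\to Z$, $i=1,\dots,n$, be continuous functions. Then the set $E=\{(x,y)\in X\times Y:\varphi_i(x)\le\psi_i(y),\ i=1,\dots,n\}$ is a set of (spectral) synthesis with respect to the algebra $V(X,Y)$.
   Context: $V(X,Y)=C(X)\hat\otimes C(Y)$ (the Varopoulos algebra) is the algebra of functions $\Phi\in C(X\times Y)$ with a representation $\Phi(x,y)=\sum_i f_i(x)g_i(y)$, $f_i\in C(X)$, $g_i\in C(Y)$, $\sum_i\|f_i\|\|g_i\|<\infty$ (sup norms), with norm the infimum of such sums over all such representations. A closed set $E\subseteq X\times Y$ is a set of spectral synthesis for $V(X,Y)$ if every $\Phi\in V(X,Y)$ vanishing on $E$ is a norm limit in $V(X,Y)$ of elements of $V(X,Y)$ each vanishing in a neighbourhood of $E$. *)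

theory Defs
  imports "HOL-Analysis.Analysis"
begin

text \<open>
  Compact metric spaces are compact subsets \<open>X\<close>, \<open>Y\<close> of types of class \<^class>\<open>metric_space\<close>, and
  elements of \<open>C(X)\<close> are complex functions on the whole type that are continuous on \<open>X\<close>. Their
  values outside \<open>X\<close> are irrelevant: every notion below only depends on the values on
  \<open>X\<close>, \<open>Y\<close> and \<open>X \<times> Y\<close>.
\<close>

text \<open>The empty space is treated separately because \<open>Sup {}\<close> is unspecified on the reals.\<close>

definition sup_norm :: "'a set \<Rightarrow> ('a \<Rightarrow> complex) \<Rightarrow> real" where
  "sup_norm X f = (if X = {} then 0 else (SUP x\<in>X. norm (f x)))"

text \<open>Finite sums are included by taking almost all \<open>f i\<close> to be zero.\<close>

definition varopoulos_rep ::
  "'a::metric_space set \<Rightarrow> 'b::metric_space set \<Rightarrow> ('a \<times> 'b \<Rightarrow> complex) \<Rightarrow>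
    (nat \<Rightarrow> 'a \<Rightarrow> complex) \<Rightarrow> (nat \<Rightarrow> 'b \<Rightarrow> complex) \<Rightarrow> bool" where
  "varopoulos_rep X Y \<Phi> f g \<longleftrightarrow>
     (\<forall>i. continuous_on X (f i)) \<and> (\<forall>i. continuous_on Y (g i)) \<and>
     summable (\<lambda>i. sup_norm X (f i) * sup_norm Y (g i)) \<and>
     (\<forall>x\<in>X. \<forall>y\<in>Y. (\<lambda>i. f i x * g i y) sums \<Phi> (x, y))"

definition varopoulos ::
  "'a::metric_space set \<Rightarrow> 'b::metric_space set \<Rightarrow> ('a \<times> 'b \<Rightarrow> complex) set" where
  "varopoulos X Y = {\<Phi>. continuous_on (X \<times> Y) \<Phi> \<and> (\<exists>f g. varopoulos_rep X Y \<Phi> f g)}"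

definition varopoulos_norm ::
  "'a::metric_space set \<Rightarrow> 'b::metric_space set \<Rightarrow> ('a \<times> 'b \<Rightarrow> complex) \<Rightarrow> real" where
  "varopoulos_norm X Y \<Phi> =
     Inf {(\<Sum>i. sup_norm X (f i) * sup_norm Y (g i)) | f g. varopoulos_rep X Y \<Phi> f g}"

text \<open>Neighbourhoods of \<open>E\<close> are taken in the subspace topology of \<open>X \<times> Y\<close>.\<close>

definition vanishes_near ::
  "'a::metric_space set \<Rightarrow> 'b::metric_space set \<Rightarrow> ('a \<times> 'b) set \<Rightarrow> ('a \<times> 'b \<Rightarrow> complex) \<Rightarrow> bool" where
  "vanishes_near X Y E \<Psi> \<longleftrightarrow>
     (\<exists>U. openin (top_of_set (X \<times> Y)) U \<and> E \<subseteq> U \<and> (\<forall>p\<in>U. \<Psi> p = 0))"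

definition spectral_synthesis ::
  "'a::metric_space set \<Rightarrow> 'b::metric_space set \<Rightarrow> ('a \<times> 'b) set \<Rightarrow> bool" where
  "spectral_synthesis X Y E \<longleftrightarrow>
     closedin (top_of_set (X \<times> Y)) E \<and>
     (\<forall>\<Phi>\<in>varopoulos X Y. (\<forall>p\<in>E. \<Phi> p = 0) \<longrightarrow>
        (\<exists>\<Psi>. (\<forall>k::nat. \<Psi> k \<in> varopoulos X Y \<and> vanishes_near X Y E (\<Psi> k)) \<and>
             (\<lambda>k. varopoulos_norm X Y (\<lambda>p. \<Phi> p - \<Psi> k p)) \<longlonglongrightarrow> 0))"

end

theory Submission
  imports Defs
begin

text \<open>
  Let \<open>\<Phi>\<close> vanish on \<open>E = {(x, y). \<phi>\<^sub>i x \<le> \<psi>\<^sub>i y for all i}\<close>. The proof is an explicit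
  approximation by partitions of unity, and adds the inequalities one at a time. To make this
  induction work, the property carried along is synthesis of the intersections of a set with all
  closed rectangles \<open>A \<times> B\<close> (\<open>rectangle_synthetic\<close>).

  Without inequalities the set is a rectangle. For \<open>\<Phi> = (\<Sum>i. f\<^sub>i \<otimes> g\<^sub>i)\<close> vanishing on
  \<open>A \<times> B\<close>, replacing each \<open>f\<^sub>i\<close> near \<open>A\<close> by an average of its values at finitely many
  points of \<open>A\<close>, and then each \<open>g\<^sub>i\<close> likewise near \<open>B\<close>, changes \<open>\<Phi>\<close> little in norm and
  yields a function which near \<open>A \<times> B\<close> is a combination of values of \<open>\<Phi>\<close> on \<open>A \<times> B\<close>,
  hence vanishes there (\<open>rectangle_synthesis\<close>).

  Now let \<open>E\<close> have the property and let \<open>\<Phi>\<close> vanish on \<open>E \<inter> {\<phi> x \<le> \<psi> y}\<close>. Cut \<open>Z\<close> into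
  \<open>n\<close> consecutive short pieces by a partition of unity, which cuts \<open>X \<times> Y\<close> into
  \<open>n\<^sup>2\<close> cells \<open>(j, k)\<close>, with \<open>\<phi> x\<close> in piece \<open>j\<close> and \<open>\<psi> y\<close> in piece \<open>k\<close>. Cells with
  \<open>j\<close> well above \<open>k\<close> do not meet the new set, so \<open>\<Phi>\<close> is left unchanged there. On cells
  with \<open>j\<close> well below \<open>k\<close> the function \<open>\<Phi>\<close> vanishes on \<open>E\<close>, so that it can be approximated
  on each of them separately, with an error that is chosen after \<open>n\<close>. The cells near the
  diagonal are the difficulty, since there \<open>n\<close> depends on the error allowed per cell. Two facts help.
  On \<open>{\<phi> x = z} \<times> {\<psi> y = z}\<close> the function \<open>\<Phi>\<close> vanishes on \<open>E\<close>, so it is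
  approximated within \<open>\<epsilon>\<close> by a function that vanishes near \<open>E\<close> on a whole neighbourhood of
  this fibre, and by compactness short enough pieces of \<open>Z\<close> fit into such neighbourhoods.
  Moreover the norm of a block-diagonal sum is bounded by the largest norm of a block,
  independently of the number of blocks (\<open>tensor_bound_block_diagonal\<close>). The order enters
  through the fact that, for consecutive pieces, boundedly many diagonals \<open>k - j = d\<close> cover all
  cells near the diagonal.
\<close>


section \<open>Representations by contractions\<close>

definition contraction_on :: "'a::metric_space set \<Rightarrow> ('a \<Rightarrow> complex) \<Rightarrow> bool" where
  "contraction_on X f \<longleftrightarrow> continuous_on X f \<and> (\<forall>x\<in>X. norm (f x) \<le> 1)"

definition atomic_rep ::
  "'a::metric_space set \<Rightarrow> 'b::metric_space set \<Rightarrow> ('i \<Rightarrow> real) \<Rightarrow> ('i \<Rightarrow> 'a \<Rightarrow> complex) \<Rightarrow>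
    ('i \<Rightarrow> 'b \<Rightarrow> complex) \<Rightarrow> real \<Rightarrow> ('a \<times> 'b \<Rightarrow> complex) \<Rightarrow> bool" where
  "atomic_rep X Y w f g r \<Phi> \<longleftrightarrow>
     (\<forall>i. 0 \<le> w i) \<and> (w has_sum r) UNIV \<and>
     (\<forall>i. contraction_on X (f i)) \<and> (\<forall>i. contraction_on Y (g i)) \<and>
     (\<forall>x\<in>X. \<forall>y\<in>Y. ((\<lambda>i. of_real (w i) * (f i x * g i y)) has_sum \<Phi> (x, y)) UNIV)"

text \<open>
  A bound for the norm of the Varopoulos algebra. Both tensor factors are normalised and the weights
  sum to exactly \<open>r\<close>, so that for \<open>r = 1\<close> the weights form a probability distribution and
  \<open>\<Phi>\<close> is the expectation of a random elementary tensor of contractions.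
\<close>

definition tensor_bound ::
  "'a::metric_space set \<Rightarrow> 'b::metric_space set \<Rightarrow> real \<Rightarrow> ('a \<times> 'b \<Rightarrow> complex) \<Rightarrow> bool" where
  "tensor_bound X Y r \<Phi> \<longleftrightarrow> (\<exists>(w::nat \<Rightarrow> real) f g. atomic_rep X Y w f g r \<Phi>)"

lemma contraction_onD:
  assumes "contraction_on X f"
  shows "continuous_on X f" "x \<in> X \<Longrightarrow> norm (f x) \<le> 1"
  using assms by (auto simp: contraction_on_def)

lemma contraction_on_minus: "contraction_on X f \<Longrightarrow> contraction_on X (\<lambda>x. - f x)"
  by (auto simp: contraction_on_def intro!: continuous_intros)

lemma contraction_on_zero [simp]: "contraction_on X (\<lambda>x. 0)"
  by (auto simp: contraction_on_def)

lemma contraction_on_weighted_sum: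
  assumes "finite J" "\<And>j. j \<in> J \<Longrightarrow> continuous_on X (a j)" "\<And>j. j \<in> J \<Longrightarrow> contraction_on X (f j)"
    and "\<And>x. x \<in> X \<Longrightarrow> (\<Sum>j\<in>J. norm (a j x)) \<le> 1"
  shows "contraction_on X (\<lambda>x. \<Sum>j\<in>J. a j x * f j x)"
  unfolding contraction_on_def
proof (intro conjI ballI)
  show "continuous_on X (\<lambda>x. \<Sum>j\<in>J. a j x * f j x)"
    using assms(2,3) by (intro continuous_intros) (auto simp: contraction_on_def)
  fix x assume x: "x \<in> X"
  have "norm (\<Sum>j\<in>J. a j x * f j x) \<le> (\<Sum>j\<in>J. norm (a j x) * 1)"
    using contraction_onD(2)[OF assms(3) x]
    by (intro sum_norm_le) (auto simp: norm_mult intro!: mult_left_le)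
  then show "norm (\<Sum>j\<in>J. a j x * f j x) \<le> 1"
    using assms(4)[OF x] by simp
qed

lemma atomic_repD:
  assumes "atomic_rep X Y w f g r \<Phi>"
  shows "0 \<le> w i" "(w has_sum r) UNIV" "contraction_on X (f i)" "contraction_on Y (g i)"
    "x \<in> X \<Longrightarrow> y \<in> Y \<Longrightarrow> ((\<lambda>i. of_real (w i) * (f i x * g i y)) has_sum \<Phi> (x, y)) UNIV"
  using assms by (auto simp: atomic_rep_def)

lemma atomic_rep_reindex:
  assumes rep: "atomic_rep X Y w f g r \<Phi>" and e: "bij e"
  shows "atomic_rep X Y (\<lambda>i. w (e i)) (\<lambda>i. f (e i)) (\<lambda>i. g (e i)) r \<Phi>"
  using rep unfolding atomic_rep_def
  by (auto simp: has_sum_reindex_bij_betw[OF e, of w]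
      has_sum_reindex_bij_betw[OF e, of "\<lambda>i. of_real (w i) * (f i _ * g i _)"])

lemma tensor_boundI:
  fixes w :: "'i \<Rightarrow> real" and e :: "nat \<Rightarrow> 'i"
  assumes "atomic_rep X Y w f g r \<Phi>" "bij e"
  shows "tensor_bound X Y r \<Phi>"
  using atomic_rep_reindex[OF assms] unfolding tensor_bound_def by blast

lemma has_sum_sum_type:
  fixes f :: "'i + 'j \<Rightarrow> 'b::{comm_monoid_add, t2_space, topological_comm_monoid_add}"
  assumes "((\<lambda>i. f (Inl i)) has_sum a) UNIV" "((\<lambda>i. f (Inr i)) has_sum b) UNIV"
  shows "(f has_sum (a + b)) UNIV"
proof -
  have "(f has_sum a) (range Inl)" "(f has_sum b) (range Inr)"
    using assms by (auto simp: has_sum_reindex o_def inj_def)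
  then have "(f has_sum (a + b)) (range Inl \<union> range Inr)"
    by (rule has_sum_Un_disjoint) auto
  also have "range Inl \<union> range Inr = (UNIV :: ('i + 'j) set)"
    by (metis UNIV_sum)
  finally show ?thesis .
qed

lemma tensor_bound_cong:
  assumes "tensor_bound X Y r \<Phi>" "\<And>x y. x \<in> X \<Longrightarrow> y \<in> Y \<Longrightarrow> \<Phi> (x, y) = \<Psi> (x, y)"
  shows "tensor_bound X Y r \<Psi>"
  using assms unfolding tensor_bound_def atomic_rep_def by simp

lemma tensor_bound_add:
  assumes "tensor_bound X Y r \<Phi>" "tensor_bound X Y s \<Psi>"
  shows "tensor_bound X Y (r + s) (\<lambda>p. \<Phi> p + \<Psi> p)"
proof -
  obtain w :: "nat \<Rightarrow> real" and f g where 1: "atomic_rep X Y w f g r \<Phi>"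
    using assms unfolding tensor_bound_def by blast
  obtain w' :: "nat \<Rightarrow> real" and f' g' where 2: "atomic_rep X Y w' f' g' s \<Psi>"
    using assms unfolding tensor_bound_def by blast
  have "atomic_rep X Y (case_sum w w') (case_sum f f') (case_sum g g') (r + s) (\<lambda>p. \<Phi> p + \<Psi> p)"
    unfolding atomic_rep_def
    using atomic_repD[OF 1] atomic_repD[OF 2]
    by (auto intro!: has_sum_sum_type split: sum.split)
  then show ?thesis
    using tensor_boundI bij_sum_decode by blast
qed

lemma tensor_bound_zero:
  assumes "0 \<le> r"
  shows "tensor_bound X Y r (\<lambda>p. 0)"
proof -
  have "((\<lambda>i::nat. if i = 0 then r else 0) has_sum r) UNIV"
    by (rule has_sum_finite_neutralI[of "{0}"]) auto
  then have "atomic_rep X Y (\<lambda>i::nat. if i = 0 then r else 0) (\<lambda>i x. 0) (\<lambda>i y. 0) r (\<lambda>p. 0)"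
    using assms unfolding atomic_rep_def by auto
  then show ?thesis
    unfolding tensor_bound_def by blast
qed

lemma tensor_bound_mono:
  assumes "tensor_bound X Y r \<Phi>" "r \<le> s"
  shows "tensor_bound X Y s \<Phi>"
  using tensor_bound_add[OF assms(1) tensor_bound_zero[of "s - r"]] assms(2) by simp

lemma tensor_bound_nonneg: "tensor_bound X Y r \<Phi> \<Longrightarrow> 0 \<le> r"
  unfolding tensor_bound_def by (meson atomic_repD(1,2) has_sum_nonneg)

lemma tensor_bound_sum:
  assumes "finite J" "\<And>j. j \<in> J \<Longrightarrow> tensor_bound X Y (r j) (\<Phi> j)"
  shows "tensor_bound X Y (\<Sum>j\<in>J. r j) (\<lambda>p. \<Sum>j\<in>J. \<Phi> j p)"
  using assms
  by (induction J rule: finite_induct) (auto intro: tensor_bound_zero tensor_bound_add)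

lemma tensor_bound_scale:
  assumes "tensor_bound X Y r \<Phi>" "0 \<le> c"
  shows "tensor_bound X Y (c * r) (\<lambda>p. of_real c * \<Phi> p)"
proof -
  obtain w :: "nat \<Rightarrow> real" and f g where 1: "atomic_rep X Y w f g r \<Phi>"
    using assms unfolding tensor_bound_def by blast
  have "atomic_rep X Y (\<lambda>i. c * w i) f g (c * r) (\<lambda>p. of_real c * \<Phi> p)"
    unfolding atomic_rep_def
    using atomic_repD[OF 1] assms(2)
    by (auto intro!: has_sum_cmult_right simp: mult.assoc)
  then show ?thesis
    unfolding tensor_bound_def by blast
qed

lemma tensor_bound_uminus:
  assumes "tensor_bound X Y r \<Phi>"
  shows "tensor_bound X Y r (\<lambda>p. - \<Phi> p)"
proof -
  obtain w :: "nat \<Rightarrow> real" and f g where 1: "atomic_rep X Y w f g r \<Phi>"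
    using assms unfolding tensor_bound_def by blast
  have "atomic_rep X Y w (\<lambda>i x. - f i x) g r (\<lambda>p. - \<Phi> p)"
    unfolding atomic_rep_def
    using atomic_repD[OF 1]
    by (auto intro!: contraction_on_minus simp: has_sum_uminus)
  then show ?thesis
    unfolding tensor_bound_def by blast
qed

lemma tensor_bound_diff:
  assumes "tensor_bound X Y r \<Phi>" "tensor_bound X Y s \<Psi>"
  shows "tensor_bound X Y (r + s) (\<lambda>p. \<Phi> p - \<Psi> p)"
  using tensor_bound_add[OF assms(1) tensor_bound_uminus[OF assms(2)]] by simp

section \<open>Block-diagonal sums\<close>

lemma weighted_contractions_abs_summable:
  fixes w :: "'i \<Rightarrow> real"
  assumes "(w has_sum r) UNIV" "\<And>i. 0 \<le> w i" "\<And>i. norm (h i) \<le> 1"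
  shows "(\<lambda>i. norm (of_real (w i) * h i :: complex)) summable_on UNIV"
proof (rule Infinite_Sum.abs_summable_on_comparison_test')
  show "w summable_on UNIV"
    using assms(1) by (auto simp: summable_on_def)
  show "norm (of_real (w i) * h i) \<le> w i" for i
    using assms(2,3)[of i] by (auto simp: norm_mult intro!: mult_left_le)
qed

text \<open>
  Multiplying both factors by the same independent random sign leaves their product unchanged, and
  gives both factors mean zero.
\<close>

lemma atomic_rep_sign_symmetric:
  assumes "tensor_bound X Y 1 \<Phi>"
  obtains w :: "nat \<Rightarrow> real" and f g where "atomic_rep X Y w f g 1 \<Phi>"
    "\<And>x. x \<in> X \<Longrightarrow> ((\<lambda>i. of_real (w i) * f i x) has_sum 0) UNIV"
    "\<And>y. y \<in> Y \<Longrightarrow> ((\<lambda>i. of_real (w i) * g i y) has_sum 0) UNIV"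
proof -
  obtain w :: "nat \<Rightarrow> real" and f g where 1: "atomic_rep X Y w f g 1 \<Phi>"
    using assms unfolding tensor_bound_def by blast
  define v where "v = case_sum (\<lambda>i. w i / 2) (\<lambda>i. w i / 2)"
  define F where "F = case_sum f (\<lambda>i x. - f i x)"
  define G where "G = case_sum g (\<lambda>i x. - g i x)"
  have abs: "(\<lambda>i. of_real (w i) * h i z :: complex) summable_on UNIV"
    if "\<And>i. contraction_on S (h i)" "z \<in> S" for S :: "'z::metric_space set" and h z
    by (rule abs_summable_summable,
        rule weighted_contractions_abs_summable[OF atomic_repD(2,1)[OF 1] contraction_onD(2)[OF that]])
  have sym: "((\<lambda>i. of_real (v i) * case_sum h (\<lambda>i x. - h i x) i z :: complex) has_sum 0) UNIV"
    if h: "\<And>i. contraction_on S (h i)" "z \<in> S" for S :: "'z::metric_space set" and h z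
  proof -
    obtain s where s: "((\<lambda>i. of_real (w i) * h i z :: complex) has_sum s) UNIV"
      using abs[of S h z] h by (auto simp: summable_on_def)
    have "((\<lambda>i. of_real (v i) * case_sum h (\<lambda>i x. - h i x) i z :: complex) has_sum
        ((1/2) * s + (-1/2) * s)) UNIV"
      by (rule has_sum_sum_type)
        (use has_sum_cmult_right[OF s, of "1/2"] has_sum_cmult_right[OF s, of "-1/2"] in
          \<open>simp_all add: v_def\<close>)
    then show ?thesis by simp
  qed
  have rep: "atomic_rep X Y v F G 1 \<Phi>"
    unfolding atomic_rep_def
  proof (intro conjI allI ballI)
    show "0 \<le> v i" "contraction_on X (F i)" "contraction_on Y (G i)" for i
      using atomic_repD[OF 1] by (auto simp: v_def F_def G_def contraction_on_minus split: sum.split)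
    have "(v has_sum (1/2 * 1 + 1/2 * 1)) UNIV"
      by (rule has_sum_sum_type)
        (use has_sum_cmult_right[OF atomic_repD(2)[OF 1], of "1/2"] in \<open>simp_all add: v_def\<close>)
    then show "(v has_sum 1) UNIV" by simp
    fix x y assume "x \<in> X" "y \<in> Y"
    note s = has_sum_cmult_right[OF atomic_repD(5)[OF 1 this], of "1/2"]
    have "((\<lambda>i. of_real (v i) * (F i x * G i y)) has_sum (1/2 * \<Phi> (x, y) + 1/2 * \<Phi> (x, y))) UNIV"
      by (rule has_sum_sum_type) (use s in \<open>simp_all add: v_def F_def G_def\<close>)
    then show "((\<lambda>i. of_real (v i) * (F i x * G i y)) has_sum \<Phi> (x, y)) UNIV" by simp
  qed
  have 2: "((\<lambda>i. of_real (v i) * F i x) has_sum 0) UNIV" if "x \<in> X" for x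
    unfolding F_def by (rule sym[of X f x, OF atomic_repD(3)[OF 1] that])
  have 3: "((\<lambda>i. of_real (v i) * G i y) has_sum 0) UNIV" if "y \<in> Y" for y
    unfolding G_def by (rule sym[of Y g y, OF atomic_repD(4)[OF 1] that])
  show ?thesis
    by (rule that[OF atomic_rep_reindex[OF rep bij_sum_decode]])
      (simp_all add: has_sum_reindex_bij_betw[OF bij_sum_decode, of "\<lambda>i. of_real (v i) * F i _"]
        has_sum_reindex_bij_betw[OF bij_sum_decode, of "\<lambda>i. of_real (v i) * G i _"] 2 3)
qed

lemma has_sum_product:
  fixes a :: "'i \<Rightarrow> complex" and b :: "'j \<Rightarrow> complex"
  assumes "(a has_sum s) UNIV" "(b has_sum t) UNIV"
    and "(\<lambda>i. norm (a i)) summable_on UNIV" "(\<lambda>j. norm (b j)) summable_on UNIV"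
  shows "((\<lambda>(i, j). a i * b j) has_sum (s * t)) UNIV"
proof -
  have sm: "(\<lambda>p. a (fst p) * b (snd p)) summable_on (UNIV \<times> UNIV)"
  proof (rule abs_summable_summable, rule summable_on_SigmaI)
    show "((\<lambda>j. norm (a (fst (i, j)) * b (snd (i, j)))) has_sum
        norm (a i) * infsum (\<lambda>j. norm (b j)) UNIV) UNIV" for i
      using has_sum_cmult_right[OF has_sum_infsum[OF assms(4)]] by (simp add: norm_mult)
    show "(\<lambda>i. norm (a i) * infsum (\<lambda>j. norm (b j)) UNIV) summable_on UNIV"
      using summable_on_cmult_left[OF assms(3)] by simp
  qed auto
  have "((\<lambda>p. a (fst p) * b (snd p)) has_sum (s * t)) (UNIV \<times> UNIV)"
  proof (rule has_sum_SigmaI[OF _ _ sm])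
    show "((\<lambda>j. a (fst (i, j)) * b (snd (i, j))) has_sum (a i * t)) UNIV" for i
      using has_sum_cmult_right[OF assms(2)] by simp
    show "((\<lambda>i. a i * t) has_sum (s * t)) UNIV"
      using has_sum_cmult_left[OF assms(1)] by simp
  qed
  then show ?thesis by (simp add: case_prod_beta')
qed

definition orthogonal_rep ::
  "'a::metric_space set \<Rightarrow> 'b::metric_space set \<Rightarrow> 'j set \<Rightarrow> ('j \<Rightarrow> 'a \<times> 'b \<Rightarrow> complex) \<Rightarrow>
    (nat \<Rightarrow> real) \<Rightarrow> (nat \<Rightarrow> 'j \<Rightarrow> 'a \<Rightarrow> complex) \<Rightarrow> (nat \<Rightarrow> 'j \<Rightarrow> 'b \<Rightarrow> complex) \<Rightarrow> bool" where
  "orthogonal_rep X Y J R w F G \<longleftrightarrow>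
     (\<forall>i. 0 \<le> w i) \<and> (w has_sum 1) UNIV \<and>
     (\<forall>i. \<forall>j\<in>J. contraction_on X (F i j) \<and> contraction_on Y (G i j)) \<and>
     (\<forall>j\<in>J. \<forall>k\<in>J. \<forall>x\<in>X. \<forall>y\<in>Y.
        ((\<lambda>i. of_real (w i) * (F i j x * G i k y)) has_sum (if j = k then R j (x, y) else 0)) UNIV)"

text \<open>
  Take probabilistic representations of all \<open>R j\<close> with mean-zero factors and make them independent
  of each other. The mean of a product of factors that belong to different indices is then zero, so
  one probability distribution serves all \<open>R j\<close> without cross terms. The number of functions
  does not enter the bound.
\<close>

lemma joint_orthogonal_rep:
  fixes R :: "'j \<Rightarrow> 'a::metric_space \<times> 'b::metric_space \<Rightarrow> complex"
  assumes "finite J" "\<And>j. j \<in> J \<Longrightarrow> tensor_bound X Y 1 (R j)"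
  shows "\<exists>w F G. orthogonal_rep X Y J R w F G"
  using assms
proof (induction J rule: finite_induct)
  case empty
  have "((\<lambda>i::nat. if i = 0 then 1 else 0 :: real) has_sum 1) UNIV"
    by (rule has_sum_finite_neutralI[of "{0}"]) auto
  then show ?case
    unfolding orthogonal_rep_def by (intro exI[of _ "\<lambda>i::nat. if i = 0 then 1 else 0"]) auto
next
  case (insert j0 J)
  obtain w F G where wFG: "orthogonal_rep X Y J R w F G"
    using insert.IH insert.prems by blast
  then have w: "\<And>i. 0 \<le> w i" "(w has_sum 1) UNIV"
    and FG: "\<And>i j. j \<in> J \<Longrightarrow> contraction_on X (F i j)" "\<And>i j. j \<in> J \<Longrightarrow> contraction_on Y (G i j)"
    and s: "\<And>j k x y. j \<in> J \<Longrightarrow> k \<in> J \<Longrightarrow> x \<in> X \<Longrightarrow> y \<in> Y \<Longrightarrow>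
        ((\<lambda>i. of_real (w i) * (F i j x * G i k y)) has_sum (if j = k then R j (x, y) else 0)) UNIV"
    unfolding orthogonal_rep_def by blast+
  obtain v :: "nat \<Rightarrow> real" and f g where rep: "atomic_rep X Y v f g 1 (R j0)"
    and f0: "\<And>x. x \<in> X \<Longrightarrow> ((\<lambda>i. of_real (v i) * f i x) has_sum 0) UNIV"
    and g0: "\<And>y. y \<in> Y \<Longrightarrow> ((\<lambda>i. of_real (v i) * g i y) has_sum 0) UNIV"
    using atomic_rep_sign_symmetric[OF insert.prems[OF insertI1]] by blast
  note v = atomic_repD[OF rep]
  define W where "W = (\<lambda>(i, i'). w i * v i')"
  define F' where "F' = (\<lambda>(i, i') j. if j = j0 then f i' else F i j)"
  define G' where "G' = (\<lambda>(i, i') j. if j = j0 then g i' else G i j)"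
  have j0: "j \<noteq> j0" if "j \<in> J" for j
    using that insert.hyps by auto
  have prod: "((\<lambda>(i, i'). of_real (w i * v i') * (a i * b i')) has_sum (p * q)) UNIV"
    if "((\<lambda>i. of_real (w i) * a i) has_sum p) UNIV" "((\<lambda>i. of_real (v i) * b i) has_sum q) UNIV"
      "\<And>i. norm (a i) \<le> 1" "\<And>i. norm (b i) \<le> 1" for a b :: "nat \<Rightarrow> complex" and p q
    using has_sum_product[OF that(1,2)
        weighted_contractions_abs_summable[OF w(2,1) that(3)]
        weighted_contractions_abs_summable[OF v(2,1) that(4)]]
    by (simp add: case_prod_beta' algebra_simps)
  have one: "((\<lambda>i. of_real (w i) * 1 :: complex) has_sum 1) UNIV"
      "((\<lambda>i. of_real (v i) * 1 :: complex) has_sum 1) UNIV"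
    using has_sum_of_real[OF w(2)] has_sum_of_real[OF v(2)] by simp_all
  have sums: "((\<lambda>i. of_real (W i) * (F' i j x * G' i k y)) has_sum (if j = k then R j (x, y) else 0)) UNIV"
    if jk: "j \<in> insert j0 J" "k \<in> insert j0 J" and xy: "x \<in> X" "y \<in> Y" for j k x y
  proof -
    have b: "norm (F i l x) \<le> 1" "norm (G i l y) \<le> 1" if "l \<in> J" for i l
      using FG that xy contraction_onD(2) by blast+
    have b': "norm (f i x) \<le> 1" "norm (g i y) \<le> 1" for i
      using v xy contraction_onD(2) by blast+
    have Fs: "\<exists>p. ((\<lambda>i. of_real (w i) * F i l x) has_sum p) UNIV"
      "\<exists>p. ((\<lambda>i. of_real (w i) * G i l y) has_sum p) UNIV" if "l \<in> J" for l
      using abs_summable_summable[OF weighted_contractions_abs_summable[OF w(2,1), of "\<lambda>i. F i l x"]]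
        abs_summable_summable[OF weighted_contractions_abs_summable[OF w(2,1), of "\<lambda>i. G i l y"]]
        b that by (auto simp: summable_on_def)
    consider "j = j0" "k = j0" | "j = j0" "k \<in> J" | "j \<in> J" "k = j0" | "j \<in> J" "k \<in> J"
      using jk by auto
    then show ?thesis
    proof cases
      case 1
      have "((\<lambda>(i, i'). of_real (w i * v i') * (1 * (f i' x * g i' y))) has_sum (1 * R j0 (x, y))) UNIV"
        using b' by (intro prod one v(5) xy) (auto simp: norm_mult intro!: mult_le_one)
      then show ?thesis
        using 1 by (simp add: W_def F'_def G'_def case_prod_beta')
    next
      case 2
      obtain p where p: "((\<lambda>i. of_real (w i) * G i k y) has_sum p) UNIV"
        using Fs(2)[OF 2(2)] by blast
      have "((\<lambda>(i, i'). of_real (w i * v i') * (G i k y * f i' x)) has_sum (p * 0)) UNIV"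
        using 2 b b' by (intro prod p f0 xy) auto
      then show ?thesis
        using 2 j0[OF 2(2)] by (simp add: W_def F'_def G'_def case_prod_beta' mult_ac)
    next
      case 3
      obtain p where p: "((\<lambda>i. of_real (w i) * F i j x) has_sum p) UNIV"
        using Fs(1)[OF 3(1)] by blast
      have "((\<lambda>(i, i'). of_real (w i * v i') * (F i j x * g i' y)) has_sum (p * 0)) UNIV"
        using 3 b b' by (intro prod p g0 xy) auto
      then show ?thesis
        using 3 j0[OF 3(1)] by (simp add: W_def F'_def G'_def case_prod_beta' mult_ac)
    next
      case 4
      have "((\<lambda>(i, i'). of_real (w i * v i') * ((F i j x * G i k y) * 1)) has_sum
          ((if j = k then R j (x, y) else 0) * 1)) UNIV"
        using 4 b by (intro prod one s xy) (auto simp: norm_mult intro!: mult_le_one)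
      then show ?thesis
        using 4 j0 by (simp add: W_def F'_def G'_def case_prod_beta')
    qed
  qed
  have Wsum: "(W has_sum 1) UNIV"
  proof -
    have "((\<lambda>(i, i'). of_real (w i * v i') * (1 * 1)) has_sum (1 * 1 :: complex)) UNIV"
      by (intro prod one) auto
    then have "((\<lambda>p. of_real (W p)) has_sum (of_real 1 :: complex)) UNIV"
      by (simp add: W_def case_prod_beta')
    then show ?thesis
      by (simp only: has_sum_of_real_iff)
  qed
  note re = has_sum_reindex_bij_betw[OF bij_prod_decode]
  show ?case
    unfolding orthogonal_rep_def
  proof (intro exI[of _ "\<lambda>i. W (prod_decode i)"] exI[of _ "\<lambda>i. F' (prod_decode i)"]
      exI[of _ "\<lambda>i. G' (prod_decode i)"] conjI allI ballI)
    show "0 \<le> W (prod_decode i)" for i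
      using w v by (auto simp: W_def case_prod_beta')
    show "((\<lambda>i. W (prod_decode i)) has_sum 1) UNIV"
      using Wsum by (simp add: re)
    show "contraction_on X (F' (prod_decode i) j)" "contraction_on Y (G' (prod_decode i) j)"
      if "j \<in> insert j0 J" for i j
      using that FG v by (auto simp: F'_def G'_def case_prod_beta')
    show "((\<lambda>i. of_real (W (prod_decode i)) * (F' (prod_decode i) j x * G' (prod_decode i) k y))
        has_sum (if j = k then R j (x, y) else 0)) UNIV"
      if "j \<in> insert j0 J" "k \<in> insert j0 J" "x \<in> X" "y \<in> Y" for j k x y
      using sums[OF that] by (simp only: re[of "\<lambda>i. of_real (W i) * (F' i j x * G' i k y)"])
  qed
qed

lemma has_sum_finite_sum:
  fixes f :: "'j \<Rightarrow> 'i \<Rightarrow> 'b::topological_comm_monoid_add"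
  assumes "finite J" "\<And>j. j \<in> J \<Longrightarrow> (f j has_sum s j) A"
  shows "((\<lambda>i. \<Sum>j\<in>J. f j i) has_sum (\<Sum>j\<in>J. s j)) A"
  using assms by (induction J rule: finite_induct) (auto intro: has_sum_add)

text \<open>
  With the random factors \<open>F j\<close>, \<open>G j\<close> of an orthogonal joint representation, the block sum is the
  expectation of \<open>(\<Sum>j. a j * F j) \<otimes> (\<Sum>k. b k * G k)\<close>, whose factors are contractions.
\<close>

lemma tensor_bound_block_diagonal:
  assumes J: "finite J" and R: "\<And>j. j \<in> J \<Longrightarrow> tensor_bound X Y r (R j)" and r: "0 \<le> r"
    and cont: "\<And>j. j \<in> J \<Longrightarrow> continuous_on X (a j)" "\<And>j. j \<in> J \<Longrightarrow> continuous_on Y (b j)"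
    and le: "\<And>x. x \<in> X \<Longrightarrow> (\<Sum>j\<in>J. norm (a j x)) \<le> 1" "\<And>y. y \<in> Y \<Longrightarrow> (\<Sum>j\<in>J. norm (b j y)) \<le> 1"
  shows "tensor_bound X Y r (\<lambda>(x, y). \<Sum>j\<in>J. a j x * b j y * R j (x, y))"
proof -
  have unit: "tensor_bound X Y 1 (\<lambda>(x, y). \<Sum>j\<in>J. a j x * b j y * S j (x, y))"
    if S: "\<And>j. j \<in> J \<Longrightarrow> tensor_bound X Y 1 (S j)" for S
  proof -
    obtain w F G where "orthogonal_rep X Y J S w F G"
      using joint_orthogonal_rep[of J X Y S] J S by blast
    then have w: "\<And>i. 0 \<le> w i" "(w has_sum 1) UNIV"
      and FG: "\<And>i j. j \<in> J \<Longrightarrow> contraction_on X (F i j)" "\<And>i j. j \<in> J \<Longrightarrow> contraction_on Y (G i j)"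
      and s: "\<And>j k x y. j \<in> J \<Longrightarrow> k \<in> J \<Longrightarrow> x \<in> X \<Longrightarrow> y \<in> Y \<Longrightarrow>
        ((\<lambda>i. of_real (w i) * (F i j x * G i k y)) has_sum (if j = k then S j (x, y) else 0)) UNIV"
      unfolding orthogonal_rep_def by blast+
    have "atomic_rep X Y w (\<lambda>i x. \<Sum>j\<in>J. a j x * F i j x) (\<lambda>i y. \<Sum>j\<in>J. b j y * G i j y) 1
        (\<lambda>(x, y). \<Sum>j\<in>J. a j x * b j y * S j (x, y))"
      unfolding atomic_rep_def
    proof (intro conjI allI ballI)
      fix x y assume xy: "x \<in> X" "y \<in> Y"
      have "((\<lambda>i. \<Sum>j\<in>J. \<Sum>k\<in>J. a j x * b k y * (of_real (w i) * (F i j x * G i k y)))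
          has_sum (\<Sum>j\<in>J. \<Sum>k\<in>J. a j x * b k y * (if j = k then S j (x, y) else 0))) UNIV"
        by (intro has_sum_finite_sum J has_sum_cmult_right s xy)
      also have "(\<Sum>j\<in>J. \<Sum>k\<in>J. a j x * b k y * (if j = k then S j (x, y) else 0)) =
          (\<Sum>j\<in>J. a j x * b j y * S j (x, y))"
        using J by (simp add: if_distrib sum.delta cong: if_cong)
      also have "(\<lambda>i. \<Sum>j\<in>J. \<Sum>k\<in>J. a j x * b k y * (of_real (w i) * (F i j x * G i k y))) =
          (\<lambda>i. of_real (w i) * ((\<Sum>j\<in>J. a j x * F i j x) * (\<Sum>j\<in>J. b j y * G i j y)))"
        unfolding sum_product by (simp add: sum_distrib_left mult_ac)
      finally show "((\<lambda>i. of_real (w i) * ((\<Sum>j\<in>J. a j x * F i j x) * (\<Sum>j\<in>J. b j y * G i j y)))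
          has_sum (case (x, y) of (x, y) \<Rightarrow> \<Sum>j\<in>J. a j x * b j y * S j (x, y))) UNIV" by simp
    qed (use w FG cont le J in \<open>auto intro!: contraction_on_weighted_sum\<close>)
    then show ?thesis
      unfolding tensor_bound_def by blast
  qed
  show ?thesis
  proof (cases "r = 0")
    case True
    have "R j (x, y) = 0" if "j \<in> J" "x \<in> X" "y \<in> Y" for j x y
    proof -
      obtain w :: "nat \<Rightarrow> real" and f g where rep: "atomic_rep X Y w f g r (R j)"
        using R \<open>j \<in> J\<close> unfolding tensor_bound_def by blast
      have "w i = 0" for i
        using nonneg_has_sum_le_0D[OF atomic_repD(2)[OF rep] _ atomic_repD(1)[OF rep] UNIV_I] True by simp
      then have "((\<lambda>i::nat. 0) has_sum R j (x, y)) UNIV"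
        using atomic_repD(5)[OF rep that(2,3)] by simp
      then show ?thesis
        using has_sum_unique has_sum_0_simp by blast
    qed
    then show ?thesis
      by (intro tensor_bound_cong[OF tensor_bound_zero[OF r]]) auto
  next
    case False
    have "tensor_bound X Y 1 (\<lambda>p. of_real (1 / r) * R j p)" if "j \<in> J" for j
      using tensor_bound_scale[OF R[OF that], of "1 / r"] r False by simp
    from tensor_bound_scale[OF unit[OF this] r]
    show ?thesis
      by (rule tensor_bound_cong[OF tensor_bound_mono])
        (use False in \<open>auto simp: sum_distrib_left mult_ac\<close>)
  qed
qed

section \<open>Comparison with the Varopoulos norm\<close>

lemma sup_norm_upper:
  assumes "compact X" "continuous_on X f" "x \<in> X"
  shows "norm (f x) \<le> sup_norm X f"
proof -
  have "compact ((\<lambda>x. norm (f x)) ` X)"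
    using assms by (intro compact_continuous_image continuous_intros)
  then have "bdd_above ((\<lambda>x. norm (f x)) ` X)"
    by (intro bounded_imp_bdd_above compact_imp_bounded)
  then have "norm (f x) \<le> (SUP x\<in>X. norm (f x))"
    by (intro cSUP_upper assms)
  then show ?thesis using assms(3) by (auto simp: sup_norm_def)
qed

lemma sup_norm_least:
  assumes "\<And>x. x \<in> X \<Longrightarrow> norm (f x) \<le> c" "0 \<le> c"
  shows "sup_norm X f \<le> c"
  using assms by (auto simp: sup_norm_def intro!: cSUP_least)

lemma sup_norm_nonneg:
  assumes "compact X" "continuous_on X f"
  shows "0 \<le> sup_norm X f"
proof (cases "X = {}")
  case False
  then obtain x where "x \<in> X" by auto
  then show ?thesis
    using sup_norm_upper[OF assms, of x] norm_ge_zero[of "f x"] by linarith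
qed (simp add: sup_norm_def)

lemma tensor_bound_series:
  fixes f :: "nat \<Rightarrow> 'a::metric_space \<Rightarrow> complex" and g :: "nat \<Rightarrow> 'b::metric_space \<Rightarrow> complex"
  assumes w: "\<And>i. 0 \<le> w i" and c: "\<And>i. 0 \<le> c i" and d: "\<And>i. 0 \<le> d i"
    and f: "\<And>i. continuous_on X (f i)" "\<And>i x. x \<in> X \<Longrightarrow> norm (f i x) \<le> c i"
    and g: "\<And>i. continuous_on Y (g i)" "\<And>i y. y \<in> Y \<Longrightarrow> norm (g i y) \<le> d i"
    and sum: "((\<lambda>i. w i * c i * d i) has_sum r) UNIV"
    and \<Phi>: "\<And>x y. x \<in> X \<Longrightarrow> y \<in> Y \<Longrightarrow> ((\<lambda>i. of_real (w i) * (f i x * g i y)) has_sum \<Phi> (x, y)) UNIV"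
  shows "tensor_bound X Y r \<Phi>"
proof -
  have "atomic_rep X Y (\<lambda>i. w i * c i * d i) (\<lambda>i x. f i x / of_real (c i)) (\<lambda>i y. g i y / of_real (d i)) r \<Phi>"
    unfolding atomic_rep_def
  proof (intro conjI allI ballI)
    show "0 \<le> w i * c i * d i" for i
      using w c d by simp
    show "((\<lambda>i. w i * c i * d i) has_sum r) UNIV" by fact
    show "contraction_on X (\<lambda>x. f i x / of_real (c i))" for i
    proof (cases "c i = 0")
      case False
      then show ?thesis using f(2)[of _ i] f(1)[of i] c[of i]
        by (auto simp: contraction_on_def norm_divide intro!: continuous_intros)
    qed simp
    show "contraction_on Y (\<lambda>y. g i y / of_real (d i))" for i
    proof (cases "d i = 0")
      case False
      then show ?thesis using g(2)[of _ i] g(1)[of i] d[of i]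
        by (auto simp: contraction_on_def norm_divide intro!: continuous_intros)
    qed simp
    fix x y assume xy: "x \<in> X" "y \<in> Y"
    have "of_real (w i * c i * d i) * (f i x / of_real (c i) * (g i y / of_real (d i))) =
        of_real (w i) * (f i x * g i y)" for i
    proof -
      consider "f i x = 0" | "g i y = 0" | "c i \<noteq> 0" "d i \<noteq> 0"
        using f(2)[OF xy(1), of i] g(2)[OF xy(2), of i] by fastforce
      then show ?thesis by cases auto
    qed
    then show "((\<lambda>i. of_real (w i * c i * d i) * (f i x / of_real (c i) * (g i y / of_real (d i))))
        has_sum \<Phi> (x, y)) UNIV"
      using \<Phi>[OF xy] by simp
  qed
  then show ?thesis
    unfolding tensor_bound_def by blast
qed

lemma varopoulos_imp_tensor_bound:
  assumes "compact X" "compact Y" "\<Phi> \<in> varopoulos X Y"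
  shows "\<exists>r. tensor_bound X Y r \<Phi>"
proof -
  obtain f g where rep: "varopoulos_rep X Y \<Phi> f g"
    using assms by (auto simp: varopoulos_def)
  then have c: "\<And>i. continuous_on X (f i)" "\<And>i. continuous_on Y (g i)"
    and sm: "summable (\<lambda>i. sup_norm X (f i) * sup_norm Y (g i))"
    and s: "\<And>x y. x \<in> X \<Longrightarrow> y \<in> Y \<Longrightarrow> (\<lambda>i. f i x * g i y) sums \<Phi> (x, y)"
    by (auto simp: varopoulos_rep_def)
  have nn: "0 \<le> sup_norm X (f i)" "0 \<le> sup_norm Y (g i)" for i
    using assms c by (auto intro: sup_norm_nonneg)
  have le: "norm (f i x * g i y) \<le> sup_norm X (f i) * sup_norm Y (g i)"
    if "x \<in> X" "y \<in> Y" for i x y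
    unfolding norm_mult using that assms c nn by (intro mult_mono sup_norm_upper) auto
  have hs: "((\<lambda>i. f i x * g i y) has_sum \<Phi> (x, y)) UNIV" if "x \<in> X" "y \<in> Y" for x y
    using summable_comparison_test'[OF sm, of 0 "\<lambda>i. norm (f i x * g i y)"] le[OF that] s[OF that]
    by (intro norm_summable_imp_has_sum) auto
  obtain r where "((\<lambda>i. 1 * sup_norm X (f i) * sup_norm Y (g i)) has_sum r) UNIV"
    using norm_summable_imp_has_sum[of "\<lambda>i. sup_norm X (f i) * sup_norm Y (g i)"] sm nn
    by (auto simp: summable_sums)
  then have "tensor_bound X Y r \<Phi>"
    using tensor_bound_series[of "\<lambda>_. 1" "\<lambda>i. sup_norm X (f i)" "\<lambda>i. sup_norm Y (g i)" X f Y g r \<Phi>]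
      assms c nn hs by (auto intro: sup_norm_upper)
  then show ?thesis by blast
qed

lemma tensor_bound_imp_varopoulos:
  assumes "compact X" "compact Y" "tensor_bound X Y r \<Phi>"
  shows "\<Phi> \<in> varopoulos X Y" "varopoulos_norm X Y \<Phi> \<le> r" "0 \<le> varopoulos_norm X Y \<Phi>"
proof -
  obtain w :: "nat \<Rightarrow> real" and f g where rep: "atomic_rep X Y w f g r \<Phi>"
    using assms unfolding tensor_bound_def by blast
  note rep = atomic_repD[OF rep]
  have wsum: "w sums r"
    by (rule has_sum_imp_sums[OF rep(2)])
  define F where "F i x = of_real (w i) * f i x" for i x
  have F: "continuous_on X (F i)" "\<And>x. x \<in> X \<Longrightarrow> norm (F i x) \<le> w i" for i
    using rep(1)[of i] contraction_onD[OF rep(3)[of i]] unfolding F_def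
    by (auto intro!: continuous_intros mult_left_le simp: norm_mult)
  have g: "continuous_on Y (g i)" "\<And>y. y \<in> Y \<Longrightarrow> norm (g i y) \<le> 1" for i
    using contraction_onD[OF rep(4)[of i]] by auto
  have nn: "0 \<le> sup_norm X (F i) * sup_norm Y (g i)" for i
    using assms F g by (intro mult_nonneg_nonneg sup_norm_nonneg) auto
  have le: "sup_norm X (F i) * sup_norm Y (g i) \<le> w i" for i
  proof -
    have "sup_norm X (F i) * sup_norm Y (g i) \<le> w i * 1"
      using assms F g rep(1)[of i] by (intro mult_mono sup_norm_least sup_norm_nonneg) auto
    then show ?thesis by simp
  qed
  have sm: "summable (\<lambda>i. sup_norm X (F i) * sup_norm Y (g i))"
  proof (rule summable_comparison_test'[of w 0])
    show "summable w" using wsum by (rule sums_summable)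
    show "norm (sup_norm X (F i) * sup_norm Y (g i)) \<le> w i" for i
      using nn[of i] le[of i] by simp
  qed
  have sums: "(\<lambda>i. F i x * g i y) sums \<Phi> (x, y)" if "x \<in> X" "y \<in> Y" for x y
    using has_sum_imp_sums[OF rep(5)[OF that]] by (simp add: F_def mult.assoc)
  have vrep: "varopoulos_rep X Y \<Phi> F g"
    unfolding varopoulos_rep_def using F(1) g(1) sm sums by blast
  have "continuous_on (X \<times> Y) \<Phi>"
  proof -
    have ul: "uniform_limit (X \<times> Y) (\<lambda>n p. \<Sum>i<n. F i (fst p) * g i (snd p))
        (\<lambda>p. suminf (\<lambda>i. F i (fst p) * g i (snd p))) sequentially"
    proof (rule Weierstrass_m_test)
      show "norm (F i (fst p) * g i (snd p)) \<le> w i" if "p \<in> X \<times> Y" for i p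
        using mult_mono[OF F(2)[of "fst p" i] g(2)[of "snd p" i]] rep(1)[of i] that
        by (auto simp: norm_mult)
      show "summable w" using wsum by (rule sums_summable)
    qed
    have partial: "continuous_on (X \<times> Y) (\<lambda>p. \<Sum>i<n. F i (fst p) * g i (snd p))" for n
      by (intro continuous_intros continuous_on_compose2[OF F(1)] continuous_on_compose2[OF g(1)]) auto
    have "continuous_on (X \<times> Y) (\<lambda>p. suminf (\<lambda>i. F i (fst p) * g i (snd p)))"
      by (rule uniform_limit_theorem[OF _ ul]) (simp_all add: partial)
    moreover have "suminf (\<lambda>i. F i (fst p) * g i (snd p)) = \<Phi> p" if "p \<in> X \<times> Y" for p
      using sums[of "fst p" "snd p"] that by (auto simp: sums_iff)
    ultimately show ?thesis
      by (simp cong: continuous_on_cong)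
  qed
  then show "\<Phi> \<in> varopoulos X Y"
    using vrep by (auto simp: varopoulos_def)
  let ?S = "{(\<Sum>i. sup_norm X (f i) * sup_norm Y (g i)) | f g. varopoulos_rep X Y \<Phi> f g}"
  have S0: "0 \<le> s" if "s \<in> ?S" for s
    using that assms unfolding varopoulos_rep_def
    by (auto intro!: suminf_nonneg mult_nonneg_nonneg sup_norm_nonneg)
  have S1: "(\<Sum>i. sup_norm X (F i) * sup_norm Y (g i)) \<in> ?S"
    using vrep by blast
  have "(\<Sum>i. sup_norm X (F i) * sup_norm Y (g i)) \<le> suminf w"
    using le sm sums_summable[OF wsum] by (rule suminf_le)
  also have "\<dots> = r" using wsum by (simp add: sums_iff)
  finally show "varopoulos_norm X Y \<Phi> \<le> r"
    unfolding varopoulos_norm_def using S0 S1 by (intro cInf_lower2[OF S1]) (auto simp: bdd_below_def)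
  show "0 \<le> varopoulos_norm X Y \<Phi>"
    unfolding varopoulos_norm_def using S0 S1 by (intro cInf_greatest) blast+
qed

section \<open>Synthesis of rectangles\<close>

lemma tensor_bound_swap:
  assumes "tensor_bound X Y r \<Phi>"
  shows "tensor_bound Y X r (\<lambda>(y, x). \<Phi> (x, y))"
proof -
  obtain w :: "nat \<Rightarrow> real" and f g where rep: "atomic_rep X Y w f g r \<Phi>"
    using assms unfolding tensor_bound_def by blast
  then have "atomic_rep Y X w g f r (\<lambda>(y, x). \<Phi> (x, y))"
    unfolding atomic_rep_def by (auto simp: mult_ac)
  then show ?thesis
    unfolding tensor_bound_def by blast
qed

text \<open>
  The bump functions are indexed by their centres. They sum to one only near \<open>A\<close>: dividing by the sum
  of the unnormalised bumps would be discontinuous where that sum vanishes, so the denominator is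
  truncated from below at half its minimum over \<open>A\<close>.
\<close>

lemma partition_of_unity_tents:
  fixes A :: "'a::metric_space set"
  assumes "compact A" "0 < \<delta>"
  obtains K p U where "finite K" "K \<subseteq> A" "open U" "A \<subseteq> U"
    "\<And>k. continuous_on UNIV (p k :: 'a \<Rightarrow> real)" "\<And>k x. 0 \<le> p k x"
    "\<And>k x. p k x \<noteq> 0 \<Longrightarrow> dist x k < \<delta>" "\<And>x. (\<Sum>k\<in>K. p k x) \<le> 1"
    "\<And>x. x \<in> U \<Longrightarrow> (\<Sum>k\<in>K. p k x) = 1"
proof -
  obtain K where K: "finite K" "K \<subseteq> A" "A \<subseteq> (\<Union>k\<in>K. ball k \<delta>)"
    using compactE_image[OF assms(1), of A "\<lambda>k. ball k \<delta>"] assms(2) by (metis UN_I centre_in_ball open_ball subsetI)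
  define u :: "'a \<Rightarrow> 'a \<Rightarrow> real" where "u k x = max 0 (\<delta> - dist x k)" for k x
  define s where "s x = (\<Sum>k\<in>K. u k x)" for x
  have u: "continuous_on S (u k)" "0 \<le> u k x" for S k x
    unfolding u_def by (auto intro!: continuous_intros)
  have s: "continuous_on S s" "0 \<le> s x" for S x
    unfolding s_def using u by (auto intro!: continuous_intros sum_nonneg)
  have "0 < s x" if "x \<in> A" for x
  proof -
    obtain k where "k \<in> K" "dist k x < \<delta>" using K(3) \<open>x \<in> A\<close> by auto
    then have "0 < u k x" by (simp add: u_def dist_commute)
    also have "u k x \<le> s x"
      unfolding s_def using \<open>k \<in> K\<close> K(1) u by (intro member_le_sum) auto
    finally show ?thesis .
  qed
  then obtain \<eta> where \<eta>: "0 < \<eta>" "\<And>x. x \<in> A \<Longrightarrow> \<eta> \<le> s x"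
  proof (cases "A = {}")
    case False
    then obtain z where "z \<in> A" "\<forall>x\<in>A. s z \<le> s x"
      using continuous_attains_inf[OF assms(1) False s(1)] by blast
    then show ?thesis using that[of "s z"] \<open>\<And>x. x \<in> A \<Longrightarrow> 0 < s x\<close> by auto
  qed (use that[of 1] in auto)
  define p where "p k x = u k x / max (s x) (\<eta> / 2)" for k x
  have m: "0 < max (s x) (\<eta> / 2)" for x using \<eta> by (simp add: less_max_iff_disj)
  have sp: "(\<Sum>k\<in>K. p k x) = s x / max (s x) (\<eta> / 2)" for x
    unfolding p_def s_def by (simp add: sum_divide_distrib)
  show ?thesis
  proof (rule that[of K "{x. \<eta> / 2 < s x}" p])
    show "open {x. \<eta> / 2 < s x}"
      using s(1)[of UNIV] by (intro open_Collect_less continuous_on_const)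
    show "A \<subseteq> {x. \<eta> / 2 < s x}"
      using \<eta> by (force intro: less_le_trans)
    show "continuous_on UNIV (p k)" for k
      unfolding p_def using u s m by (intro continuous_intros) (auto simp: less_imp_neq[symmetric])
    show "0 \<le> p k x" for k x
      unfolding p_def using u(2)[of k x] less_imp_le[OF m[of x]] by simp
    show "dist x k < \<delta>" if "p k x \<noteq> 0" for k x
      using that by (auto simp: p_def u_def max_def split: if_splits)
    show "(\<Sum>k\<in>K. p k x) \<le> 1" for x
      unfolding sp using m[of x] by (simp add: divide_le_eq)
    show "(\<Sum>k\<in>K. p k x) = 1" if "x \<in> {x. \<eta> / 2 < s x}" for x
      unfolding sp using that \<eta> by auto
  qed (use K in auto)
qed

text \<open>
  Near \<open>A\<close> the function \<open>\<Psi>\<close> is \<open>(\<Sum>k\<in>K. p k x * \<Phi> (k, y))\<close> for a fine partition of unity \<open>p\<close> with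
  centres in a finite set \<open>K \<subseteq> A\<close>. Hence it inherits zeros of \<open>\<Phi>\<close> on \<open>A \<times> {y}\<close>. The conclusion
  refers to each \<open>y\<close> separately so that the same lemma can afterwards be applied in the other
  variable.
\<close>

lemma spread_vanishing_first_variable:
  assumes X: "compact X" and A: "compact A" "A \<subseteq> X"
    and \<Phi>: "tensor_bound X Y r \<Phi>" and \<epsilon>: "0 < \<epsilon>"
  shows "\<exists>\<Psi> U. tensor_bound X Y \<epsilon> (\<lambda>p. \<Phi> p - \<Psi> p) \<and> open U \<and> A \<subseteq> U \<and>
    (\<forall>x\<in>U \<inter> X. \<forall>y\<in>Y. (\<forall>a\<in>A. \<Phi> (a, y) = 0) \<longrightarrow> \<Psi> (x, y) = 0)"
proof -
  obtain w :: "nat \<Rightarrow> real" and f g where rep: "atomic_rep X Y w f g r \<Phi>"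
    using \<Phi> unfolding tensor_bound_def by blast
  note rep = atomic_repD[OF rep]
  have f: "continuous_on X (f i)" "\<And>x. x \<in> X \<Longrightarrow> norm (f i x) \<le> 1" for i
    using contraction_onD[OF rep(3)[of i]] by auto
  have g: "continuous_on Y (g i)" "\<And>y. y \<in> Y \<Longrightarrow> norm (g i y) \<le> 1" for i
    using contraction_onD[OF rep(4)[of i]] by auto
  have r: "0 \<le> r" by (rule tensor_bound_nonneg[OF \<Phi>])
  \<comment> \<open>The first \<open>N\<close> functions \<open>f i\<close> vary by less than \<open>\<eta>\<close> on the supports of the \<open>p k\<close>, which costs at most
    \<open>r * \<eta>\<close>; the remaining ones vary by at most 2, and their weights sum to less than \<open>\<epsilon> / 4\<close>.\<close>
  define \<eta> where "\<eta> = \<epsilon> / (2 * (r + 1))"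
  have \<eta>: "0 < \<eta>" "r * \<eta> \<le> \<epsilon> / 2"
    using r \<epsilon> by (auto simp: \<eta>_def field_simps)
  obtain N where N: "r - (\<Sum>i<N. w i) < \<epsilon> / 4"
  proof -
    have "\<forall>\<^sub>F n in sequentially. r - \<epsilon> / 4 < (\<Sum>i<n. w i)"
      using has_sum_imp_sums[OF rep(2)] \<epsilon> unfolding sums_def by (intro order_tendstoD) auto
    then obtain N where "r - \<epsilon> / 4 < (\<Sum>i<N. w i)"
      by (auto simp: eventually_sequentially)
    then show ?thesis
      using that[of N] by simp
  qed
  have "\<exists>\<delta>>0. \<forall>x\<in>X. \<forall>x'\<in>X. dist x x' < \<delta> \<longrightarrow> dist (f i x) (f i x') < \<eta>" for i
    using compact_uniformly_continuous[OF f(1) X] \<eta>(1) unfolding uniformly_continuous_on_def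
    by (metis dist_commute)
  then obtain d where d: "\<And>i. 0 < d i"
    "\<And>i x x'. x \<in> X \<Longrightarrow> x' \<in> X \<Longrightarrow> dist x x' < d i \<Longrightarrow> dist (f i x) (f i x') < \<eta>"
    by metis
  define \<delta> where "\<delta> = Min (insert 1 (d ` {..<N}))"
  have \<delta>: "0 < \<delta>" "\<And>i. i < N \<Longrightarrow> \<delta> \<le> d i"
    using d(1) by (auto simp: \<delta>_def)
  obtain K p U where K: "finite K" "K \<subseteq> A" and U: "open U" "A \<subseteq> U"
    and p: "\<And>k. continuous_on UNIV (p k :: 'a \<Rightarrow> real)" "\<And>k x. 0 \<le> p k x"
    "\<And>k x. p k x \<noteq> 0 \<Longrightarrow> dist x k < \<delta>" "\<And>x. (\<Sum>k\<in>K. p k x) \<le> 1"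
    "\<And>x. x \<in> U \<Longrightarrow> (\<Sum>k\<in>K. p k x) = 1"
    using partition_of_unity_tents[OF A(1) \<delta>(1)] by metis
  define h where "h i x = (\<Sum>k\<in>K. of_real (p k x) * (f i x - f i k))" for i x
  define c where "c i = (if i < N then \<eta> else 2)" for i
  define E where "E = (\<lambda>(x, y). \<Sum>k\<in>K. of_real (p k x) * (\<Phi> (x, y) - \<Phi> (k, y)))"
  have KX: "k \<in> X" if "k \<in> K" for k using that K(2) A(2) by auto
  have h: "norm (h i x) \<le> c i" if "x \<in> X" for i x
  proof -
    have "norm (of_real (p k x) * (f i x - f i k)) \<le> p k x * c i" if "k \<in> K" for k
    proof (cases "p k x = 0")
      case False
      have "norm (f i x - f i k) \<le> c i"
      proof (cases "i < N")
        case True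
        then show ?thesis
          using d(2)[OF \<open>x \<in> X\<close> KX[OF that], of i] p(3)[OF False] \<delta>(2)[OF True]
          by (auto simp: c_def dist_norm)
      next
        case False
        then show ?thesis
          using norm_triangle_ineq4[of "f i x" "f i k"] f(2)[OF \<open>x \<in> X\<close>, of i] f(2)[OF KX[OF that], of i]
          by (simp add: c_def)
      qed
      then show ?thesis
        using p(2)[of k x] by (simp add: norm_mult mult_left_mono)
    qed simp
    then have "norm (h i x) \<le> (\<Sum>k\<in>K. p k x * c i)"
      unfolding h_def by (rule sum_norm_le)
    also have "\<dots> = (\<Sum>k\<in>K. p k x) * c i" by (simp add: sum_distrib_right)
    also have "\<dots> \<le> 1 * c i"
      using p(4)[of x] \<eta>(1) by (intro mult_right_mono) (auto simp: c_def)
    finally show ?thesis by simp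
  qed
  have hcont: "continuous_on X (h i)" for i
    unfolding h_def using f(1) p(1)
    by (intro continuous_intros) (auto intro: continuous_on_subset)
  obtain s where s: "((\<lambda>i. w i * c i * 1) has_sum s) UNIV" "s \<le> \<epsilon>"
  proof -
    have "((\<lambda>i. if i < N then w i else 0) has_sum (\<Sum>i<N. w i)) UNIV"
      by (rule has_sum_finite_neutralI[of "{..<N}"]) (auto intro!: sum.cong)
    from has_sum_add[OF rep(2) has_sum_uminusI[OF this]]
    have tail: "((\<lambda>i. w i - (if i < N then w i else 0)) has_sum (r - (\<Sum>i<N. w i))) UNIV"
      by simp
    have major: "((\<lambda>i. \<eta> * w i + 2 * (w i - (if i < N then w i else 0))) has_sum
        (\<eta> * r + 2 * (r - (\<Sum>i<N. w i)))) UNIV"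
      by (intro has_sum_add has_sum_cmult_right rep(2) tail)
    have le: "w i * c i * 1 \<le> \<eta> * w i + 2 * (w i - (if i < N then w i else 0))" "0 \<le> w i * c i * 1" for i
      using rep(1)[of i] \<eta>(1) by (auto simp: c_def)
    have "(\<lambda>i. w i * c i * 1) summable_on UNIV"
      using major le by (intro summable_on_comparison_test[OF has_sum_imp_summable]) auto
    then obtain s where s: "((\<lambda>i. w i * c i * 1) has_sum s) UNIV"
      by (auto simp: summable_on_def)
    moreover have "s \<le> \<eta> * r + 2 * (r - (\<Sum>i<N. w i))"
      using le by (intro has_sum_mono[OF s major]) auto
    ultimately show ?thesis
      using that[of s] \<eta>(2) N by (simp add: mult.commute)
  qed
  have "tensor_bound X Y s E"
  proof (rule tensor_bound_series[where w = w and c = c and d = "\<lambda>_. 1" and f = h and g = g])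
    show "((\<lambda>i. of_real (w i) * (h i x * g i y)) has_sum E (x, y)) UNIV" if xy: "x \<in> X" "y \<in> Y" for x y
    proof -
      have "((\<lambda>i. of_real (w i) * (f i x * g i y) - of_real (w i) * (f i k * g i y)) has_sum
          (\<Phi> (x, y) - \<Phi> (k, y))) UNIV" if "k \<in> K" for k
        using has_sum_add[OF rep(5)[OF xy] has_sum_uminusI[OF rep(5)[OF KX[OF that] xy(2)]]] by simp
      then have "((\<lambda>i. \<Sum>k\<in>K. of_real (p k x) * (of_real (w i) * (f i x * g i y) - of_real (w i) * (f i k * g i y)))
          has_sum (\<Sum>k\<in>K. of_real (p k x) * (\<Phi> (x, y) - \<Phi> (k, y)))) UNIV"
        by (intro has_sum_finite_sum K has_sum_cmult_right)
      then show ?thesis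
        by (simp add: h_def E_def sum_distrib_left sum_distrib_right algebra_simps)
    qed
  qed (use rep(1) \<eta>(1) h hcont g s in \<open>auto simp: c_def\<close>)
  then have "tensor_bound X Y \<epsilon> E"
    using s(2) by (rule tensor_bound_mono)
  moreover have "\<Phi> (x, y) - E (x, y) = 0"
    if "x \<in> U \<inter> X" "y \<in> Y" "\<forall>a\<in>A. \<Phi> (a, y) = 0" for x y
  proof -
    have "E (x, y) = (\<Sum>k\<in>K. of_real (p k x) * \<Phi> (x, y))"
      using that K(2) by (auto simp: E_def intro!: sum.cong)
    also have "\<dots> = of_real (\<Sum>k\<in>K. p k x) * \<Phi> (x, y)"
      by (simp add: sum_distrib_right)
    also have "\<dots> = \<Phi> (x, y)" using p(5) that(1) by auto
    finally show ?thesis by simp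
  qed
  ultimately show ?thesis
    by (intro exI[of _ "\<lambda>p. \<Phi> p - E p"] exI[of _ U]) (use U in auto)
qed

text \<open>
  Zeros are spread from \<open>A \<times> B\<close> to \<open>U \<times> B\<close> in the first variable, and from there to \<open>U \<times> V\<close> in
  the second.
\<close>

lemma rectangle_synthesis:
  assumes "compact X" "compact Y" "compact A" "A \<subseteq> X" "compact B" "B \<subseteq> Y"
    and \<Phi>: "tensor_bound X Y r \<Phi>" "\<And>x y. x \<in> A \<Longrightarrow> y \<in> B \<Longrightarrow> \<Phi> (x, y) = 0" and \<epsilon>: "0 < \<epsilon>"
  shows "\<exists>\<Psi>. vanishes_near X Y (A \<times> B) \<Psi> \<and> tensor_bound X Y \<epsilon> (\<lambda>p. \<Phi> p - \<Psi> p)"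
proof -
  have \<epsilon>2: "0 < \<epsilon> / 2" using \<epsilon> by simp
  obtain \<Phi>' U where 1: "tensor_bound X Y (\<epsilon> / 2) (\<lambda>p. \<Phi> p - \<Phi>' p)" "open U" "A \<subseteq> U"
    "\<forall>x\<in>U \<inter> X. \<forall>y\<in>Y. (\<forall>a\<in>A. \<Phi> (a, y) = 0) \<longrightarrow> \<Phi>' (x, y) = 0"
    using spread_vanishing_first_variable[OF assms(1,3,4) \<Phi>(1) \<epsilon>2] by blast
  have "tensor_bound X Y (r + \<epsilon> / 2) \<Phi>'"
    using tensor_bound_diff[OF \<Phi>(1) 1(1)] by simp
  then have \<Phi>': "tensor_bound Y X (r + \<epsilon> / 2) (\<lambda>(y, x). \<Phi>' (x, y))"
    by (rule tensor_bound_swap)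
  obtain \<Phi>'' V where 2: "tensor_bound Y X (\<epsilon> / 2) (\<lambda>p. (case p of (y, x) \<Rightarrow> \<Phi>' (x, y)) - \<Phi>'' p)" "open V" "B \<subseteq> V"
    "\<forall>y\<in>V \<inter> Y. \<forall>x\<in>X. (\<forall>b\<in>B. \<Phi>' (x, b) = 0) \<longrightarrow> \<Phi>'' (y, x) = 0"
    using spread_vanishing_first_variable[OF assms(2,5,6) \<Phi>' \<epsilon>2] unfolding prod.case by blast
  have "tensor_bound X Y (\<epsilon> / 2) (\<lambda>p. \<Phi>' p - \<Phi>'' (snd p, fst p))"
    by (rule tensor_bound_cong[OF tensor_bound_swap[OF 2(1)]]) simp
  from tensor_bound_add[OF 1(1) this]
  have "tensor_bound X Y \<epsilon> (\<lambda>p. \<Phi> p - \<Phi>'' (snd p, fst p))" by simp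
  moreover have "vanishes_near X Y (A \<times> B) (\<lambda>p. \<Phi>'' (snd p, fst p))"
    unfolding vanishes_near_def
  proof (intro exI[of _ "(U \<inter> X) \<times> (V \<inter> Y)"] conjI)
    have "(U \<inter> X) \<times> (V \<inter> Y) = (X \<times> Y) \<inter> (U \<times> V)" by auto
    then show "openin (top_of_set (X \<times> Y)) ((U \<inter> X) \<times> (V \<inter> Y))"
      using 1(2) 2(2) by (metis open_Times openin_open)
    show "A \<times> B \<subseteq> (U \<inter> X) \<times> (V \<inter> Y)" using 1 2 assms by auto
    have "\<Phi>'' (y, x) = 0" if "x \<in> U \<inter> X" "y \<in> V \<inter> Y" for x y
    proof -
      have "\<forall>b\<in>B. \<Phi>' (x, b) = 0"
        using 1(4) \<Phi>(2) that(1) assms(6) by blast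
      then show ?thesis
        using 2(4) that by blast
    qed
    then show "\<forall>p\<in>(U \<inter> X) \<times> (V \<inter> Y). \<Phi>'' (snd p, fst p) = 0" by auto
  qed
  ultimately show ?thesis by blast
qed

section \<open>Monotone functions on an ordered compact metric space\<close>

lemma continuous_on_Sup_compact:
  fixes u :: "'a::metric_space \<Rightarrow> 'b::metric_space \<Rightarrow> real"
  assumes "compact S" "S \<noteq> {}" "compact T" "continuous_on (S \<times> T) (\<lambda>(s, t). u s t)"
  shows "continuous_on T (\<lambda>t. SUP s\<in>S. u s t)"
    and "\<And>s t. s \<in> S \<Longrightarrow> t \<in> T \<Longrightarrow> u s t \<le> (SUP s\<in>S. u s t)"
proof -
  have bdd: "bdd_above ((\<lambda>s. u s t) ` S)" if "t \<in> T" for t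
  proof -
    have "continuous_on S (\<lambda>s. (\<lambda>(s, t). u s t) (s, t))"
      using that by (intro continuous_on_compose2[OF assms(4)] continuous_intros) auto
    then show ?thesis
      using assms(1) by (intro bounded_imp_bdd_above compact_imp_bounded compact_continuous_image) auto
  qed
  show upper: "u s t \<le> (SUP s\<in>S. u s t)" if "s \<in> S" "t \<in> T" for s t
    by (rule cSUP_upper[OF that(1) bdd[OF that(2)]])
  have "uniformly_continuous_on (S \<times> T) (\<lambda>(s, t). u s t)"
    using assms by (intro compact_uniformly_continuous compact_Times)
  note uc = this[unfolded uniformly_continuous_on_def, rule_format]
  show "continuous_on T (\<lambda>t. SUP s\<in>S. u s t)"
    unfolding continuous_on_iff
  proof (intro ballI allI impI)
    fix t and \<epsilon> :: real assume t: "t \<in> T" and \<epsilon>: "0 < \<epsilon>"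
    obtain d where d: "0 < d" "\<And>s t t'. s \<in> S \<Longrightarrow> t \<in> T \<Longrightarrow> t' \<in> T \<Longrightarrow> dist t' t < d \<Longrightarrow>
        dist (u s t') (u s t) < \<epsilon> / 2"
      using uc[of "\<epsilon> / 2"] \<epsilon> by (force simp: dist_Pair_Pair)
    have le: "(SUP s\<in>S. u s t1) \<le> (SUP s\<in>S. u s t2) + \<epsilon> / 2"
      if "t1 \<in> T" "t2 \<in> T" "dist t1 t2 < d" for t1 t2
    proof (rule cSUP_least[OF assms(2)])
      fix s assume "s \<in> S"
      then show "u s t1 \<le> (SUP s\<in>S. u s t2) + \<epsilon> / 2"
        using d(2)[OF \<open>s \<in> S\<close> that(2,1,3)] upper[OF \<open>s \<in> S\<close> that(2)]
        unfolding dist_real_def by linarith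
    qed
    have "dist (SUP s\<in>S. u s t') (SUP s\<in>S. u s t) < \<epsilon>" if "t' \<in> T" "dist t' t < d" for t'
      using le[of t t'] le[of t' t] t that \<epsilon> by (simp add: dist_real_def dist_commute abs_if)
    then show "\<exists>d>0. \<forall>t'\<in>T. dist t' t < d \<longrightarrow> dist (SUP s\<in>S. u s t') (SUP s\<in>S. u s t) < \<epsilon>"
      using d(1) by blast
  qed
qed

text \<open>
  Such a function is the running maximum over \<open>s \<le> t\<close> of the distance of \<open>max s z\<close> to \<open>z\<close>. The
  points \<open>s \<le> t\<close> of \<open>Z\<close> are written \<open>min s t\<close> with \<open>s\<close> ranging over all of \<open>Z\<close>, so that the
  supremum is taken over a fixed compact set and depends continuously on \<open>t\<close>.
\<close>

lemma monotone_function_above_point: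
  fixes Z :: "'c::{metric_space, linorder_topology} set"
  assumes "compact Z" "Z \<noteq> {}"
  shows "\<exists>P :: 'c \<Rightarrow> real. continuous_on Z P \<and> mono_on Z P \<and>
    (\<forall>t\<in>Z. (t \<le> z \<longrightarrow> P t = 0) \<and> (z < t \<longrightarrow> 0 < P t))"
proof (intro exI conjI ballI impI)
  define P where "P t = (SUP s\<in>Z. dist (max (min s t) z) z)" for t
  have cont: "continuous_on (Z \<times> Z) (\<lambda>(s, t). dist (max (min s t) z) z)"
    unfolding case_prod_beta' by (intro continuous_intros)
  note P = continuous_on_Sup_compact[OF assms assms(1) cont]
  show "continuous_on Z P"
    unfolding P_def by (rule P)
  show "mono_on Z P"
  proof (rule mono_onI)
    fix t t' assume t: "t \<in> Z" "t' \<in> Z" "t \<le> t'"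
    show "P t \<le> P t'"
      unfolding P_def
    proof (rule cSUP_least[OF assms(2)])
      fix s assume "s \<in> Z"
      then have "min s t \<in> Z" "min (min s t) t' = min s t"
        using t by (auto simp: min_def)
      then show "dist (max (min s t) z) z \<le> (SUP s\<in>Z. dist (max (min s t') z) z)"
        using P(2)[of "min s t" t'] t(2) by simp
    qed
  qed
  fix t assume t: "t \<in> Z"
  show "P t = 0" if "t \<le> z"
  proof -
    have "max (min s t) z = z" for s using that by (auto simp: max_def min_def)
    then show ?thesis using assms(2) by (simp add: P_def)
  qed
  show "0 < P t" if "z < t"
  proof -
    have "0 < dist (max (min t t) z) z" using that by (auto simp: max_def)
    also have "\<dots> \<le> P t" unfolding P_def by (rule P(2)[OF t t])
    finally show ?thesis .
  qed
qed

lemma monotone_function_below_point: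
  fixes Z :: "'c::{metric_space, linorder_topology} set"
  assumes "compact Z" "Z \<noteq> {}"
  shows "\<exists>P :: 'c \<Rightarrow> real. continuous_on Z P \<and> mono_on Z P \<and>
    (\<forall>t\<in>Z. (z \<le> t \<longrightarrow> P t = 0) \<and> (t < z \<longrightarrow> P t < 0))"
proof (intro exI conjI ballI impI)
  define P where "P t = (SUP s\<in>Z. dist (min (max s t) z) z)" for t
  have cont: "continuous_on (Z \<times> Z) (\<lambda>(s, t). dist (min (max s t) z) z)"
    unfolding case_prod_beta' by (intro continuous_intros)
  note P = continuous_on_Sup_compact[OF assms assms(1) cont]
  show "continuous_on Z (\<lambda>t. - P t)"
    unfolding P_def by (intro continuous_intros P)
  show "mono_on Z (\<lambda>t. - P t)"
  proof (rule mono_onI)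
    fix t t' assume t: "t \<in> Z" "t' \<in> Z" "t \<le> t'"
    have "P t' \<le> P t"
      unfolding P_def
    proof (rule cSUP_least[OF assms(2)])
      fix s assume "s \<in> Z"
      then have "max s t' \<in> Z" "max (max s t') t = max s t'"
        using t by (auto simp: max_def)
      then show "dist (min (max s t') z) z \<le> (SUP s\<in>Z. dist (min (max s t) z) z)"
        using P(2)[of "max s t'" t] t(1) by simp
    qed
    then show "- P t \<le> - P t'" by simp
  qed
  fix t assume t: "t \<in> Z"
  show "- P t = 0" if "z \<le> t"
  proof -
    have "min (max s t) z = z" for s using that by (auto simp: max_def min_def)
    then show ?thesis using assms(2) by (simp add: P_def)
  qed
  show "- P t < 0" if "t < z"
  proof -
    have "0 < dist (min (max t t) z) z" using that by (auto simp: min_def)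
    also have "\<dots> \<le> P t" unfolding P_def by (rule P(2)[OF t t])
    finally show ?thesis by simp
  qed
qed

lemma monotone_function_isolating_point:
  fixes Z :: "'c::{metric_space, linorder_topology} set"
  assumes "compact Z" "z \<in> Z" "open N" "z \<in> N"
  shows "\<exists>(F :: 'c \<Rightarrow> real) c. continuous_on Z F \<and> mono_on Z F \<and> F z = 0 \<and> 0 < c \<and>
    (\<forall>t\<in>Z. \<bar>F t\<bar> < c \<longrightarrow> t \<in> N)"
proof -
  have ne: "Z \<noteq> {}" using assms by auto
  obtain P Q :: "'c \<Rightarrow> real" where P: "continuous_on Z P" "mono_on Z P"
    "\<forall>t\<in>Z. (t \<le> z \<longrightarrow> P t = 0) \<and> (z < t \<longrightarrow> 0 < P t)"
    and Q: "continuous_on Z Q" "mono_on Z Q" "\<forall>t\<in>Z. (z \<le> t \<longrightarrow> Q t = 0) \<and> (t < z \<longrightarrow> Q t < 0)"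
    using monotone_function_above_point[OF assms(1) ne, of z]
      monotone_function_below_point[OF assms(1) ne, of z] by blast
  define F where "F t = P t + Q t" for t
  have F: "continuous_on Z F" "mono_on Z F" "F z = 0"
    unfolding F_def using P Q assms(2) by (auto intro!: continuous_intros mono_onI add_mono dest: mono_onD)
  have Fpos: "0 < \<bar>F t\<bar>" if "t \<in> Z" "t \<noteq> z" for t
    using that P(3) Q(3) by (cases "t < z") (auto simp: F_def)
  have "compact (Z - N)" using assms by (intro compact_diff)
  have "\<exists>c>0. \<forall>t\<in>Z - N. c \<le> \<bar>F t\<bar>"
  proof (cases "Z - N = {}")
    case False
    have "continuous_on (Z - N) (\<lambda>t. \<bar>F t\<bar>)"
      by (intro continuous_intros continuous_on_subset[OF F(1)]) auto
    then obtain s where "s \<in> Z - N" "\<forall>t\<in>Z - N. \<bar>F s\<bar> \<le> \<bar>F t\<bar>"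
      using continuous_attains_inf[OF \<open>compact (Z - N)\<close> False] by blast
    then show ?thesis using Fpos[of s] assms by (intro exI[of _ "\<bar>F s\<bar>"]) auto
  qed (auto intro: exI[of _ 1])
  then obtain c where "0 < c" "\<forall>t\<in>Z - N. c \<le> \<bar>F t\<bar>" by blast
  then have "\<forall>t\<in>Z. \<bar>F t\<bar> < c \<longrightarrow> t \<in> N" by force
  then show ?thesis using F \<open>0 < c\<close> by blast
qed

text \<open>
  A Lebesgue number lemma in which distances are measured by a single monotone real function. By
  compactness finitely many monotone functions, each isolating one point, suffice; since all of them
  are monotone, the increments of their sum dominate the increments of each of them. This replaces an
  order embedding of \<open>Z\<close> into the real line.
\<close>

lemma monotone_lebesgue_number:
  fixes Z :: "'c::{metric_space, linorder_topology} set" and C :: real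
  assumes Z: "compact Z" and N: "\<And>z. z \<in> Z \<Longrightarrow> open (N z)" "\<And>z. z \<in> Z \<Longrightarrow> z \<in> N z" and C: "0 < C"
  shows "\<exists>h. continuous_on Z h \<and> mono_on Z h \<and> (\<forall>s\<in>Z. \<exists>z\<in>Z. \<forall>t\<in>Z. \<bar>h s - h t\<bar> < C \<longrightarrow> t \<in> N z)"
proof -
  define isolates where "isolates z F c \<longleftrightarrow> continuous_on Z F \<and> mono_on Z F \<and> F z = 0 \<and> 0 < c \<and>
      (\<forall>t\<in>Z. \<bar>F t\<bar> < c \<longrightarrow> t \<in> N z)" for z and F :: "'c \<Rightarrow> real" and c
  have "\<forall>z\<in>Z. \<exists>p. isolates z (fst p) (snd p)"
    using monotone_function_isolating_point[OF Z _ N] unfolding isolates_def by force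
  from bchoice[OF this] obtain G where G: "\<forall>z\<in>Z. isolates z (fst (G z)) (snd (G z))" ..
  define F c where "F z = fst (G z)" and "c z = snd (G z)" for z
  have F: "continuous_on Z (F z)" "mono_on Z (F z)" "F z z = 0" "0 < c z"
    "\<And>t. t \<in> Z \<Longrightarrow> \<bar>F z t\<bar> < c z \<Longrightarrow> t \<in> N z" if "z \<in> Z" for z
    using G that unfolding isolates_def F_def c_def by auto
  have "\<exists>W. open W \<and> {t \<in> Z. \<bar>F z t\<bar> < c z / 2} = Z \<inter> W" if "z \<in> Z" for z
  proof -
    have "openin (top_of_set Z) (Z \<inter> (\<lambda>t. \<bar>F z t\<bar>) -` {..<c z / 2})"
      using F(1)[OF that] by (intro continuous_openin_preimage_gen continuous_intros) auto
    then show ?thesis unfolding openin_open by (auto simp: vimage_def Int_def)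
  qed
  then obtain W where W: "\<And>z. z \<in> Z \<Longrightarrow> open (W z)"
    "\<And>z. z \<in> Z \<Longrightarrow> {t \<in> Z. \<bar>F z t\<bar> < c z / 2} = Z \<inter> W z"
    by metis
  have cover: "Z \<subseteq> (\<Union>z\<in>Z. W z)"
  proof
    fix z assume z: "z \<in> Z"
    then have "z \<in> {t \<in> Z. \<bar>F z t\<bar> < c z / 2}" using F(3,4) by simp
    then show "z \<in> (\<Union>z\<in>Z. W z)" using W(2) z by blast
  qed
  obtain D where "D \<subseteq> Z" "finite D" "Z \<subseteq> (\<Union>z\<in>D. W z)"
    by (rule compactE_image[OF Z W(1) cover])
  then have D: "finite D" "D \<subseteq> Z" "Z \<subseteq> (\<Union>z\<in>D. W z)" by auto
  define h where "h t = (\<Sum>z\<in>D. (2 * C / c z) * F z t)" for t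
  have Fz: "continuous_on Z (F z)" "mono_on Z (F z)" "0 < c z" if "z \<in> D" for z
    using that D(2) F by auto
  have term_le: "(2 * C / c z) * F z s \<le> (2 * C / c z) * F z t"
    if "z \<in> D" "s \<in> Z" "t \<in> Z" "s \<le> t" for z s t
    using that Fz(3)[OF that(1)] C by (intro mult_left_mono mono_onD[OF Fz(2)]) auto
  have diff_le: "(2 * C / c z) * (F z t - F z s) \<le> h t - h s"
    if "z \<in> D" "s \<in> Z" "t \<in> Z" "s \<le> t" for z s t
  proof -
    have "(2 * C / c z) * F z t - (2 * C / c z) * F z s \<le>
        (\<Sum>z\<in>D. (2 * C / c z) * F z t - (2 * C / c z) * F z s)"
      using term_le[OF _ that(2-4)] D(1) that(1)
      by (intro member_le_sum[where f = "\<lambda>z. (2 * C / c z) * F z t - (2 * C / c z) * F z s"]) auto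
    then show ?thesis by (simp add: h_def sum_subtractf right_diff_distrib)
  qed
  show ?thesis
  proof (intro exI conjI ballI)
    show "continuous_on Z h"
      unfolding h_def using Fz(1) by (intro continuous_intros)
    show "mono_on Z h"
      unfolding h_def by (intro mono_onI sum_mono term_le)
    fix s assume s: "s \<in> Z"
    then obtain z where z: "z \<in> D" "s \<in> W z" using D(3) by auto
    then have Fs: "\<bar>F z s\<bar> < c z / 2" using s W(2)[of z] D(2) by auto
    have "t \<in> N z" if t: "t \<in> Z" "\<bar>h s - h t\<bar> < C" for t
    proof -
      have "(2 * C / c z) * \<bar>F z t - F z s\<bar> \<le> \<bar>h s - h t\<bar>"
      proof (cases "s \<le> t")
        case True
        then show ?thesis
          using diff_le[OF z(1) s t(1)] mono_onD[OF Fz(2)[OF z(1)] s t(1)] by simp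
      next
        case False
        then have "t \<le> s" using linear by blast
        then show ?thesis
          using diff_le[OF z(1) t(1) s] mono_onD[OF Fz(2)[OF z(1)] t(1) s] by simp
      qed
      then have "(2 * C / c z) * \<bar>F z t - F z s\<bar> < C" using t(2) by simp
      then have "\<bar>F z t - F z s\<bar> < c z / 2"
        using C Fz(3)[OF z(1)] by (simp add: field_simps)
      then have "\<bar>F z t\<bar> < c z" using Fs by linarith
      then show ?thesis using F(5)[OF _ t(1)] z D by auto
    qed
    then show "\<exists>z\<in>Z. \<forall>t\<in>Z. \<bar>h s - h t\<bar> < C \<longrightarrow> t \<in> N z"
      using z D by blast
  qed
qed

section \<open>Vanishing near a set, and synthesis in rectangles\<close>

lemma vanishes_near_open_iff:
  "vanishes_near X Y E \<Psi> \<longleftrightarrow> (\<exists>T. open T \<and> E \<subseteq> X \<times> Y \<inter> T \<and> (\<forall>p\<in>X \<times> Y \<inter> T. \<Psi> p = 0))"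
  unfolding vanishes_near_def openin_open by blast

lemma vanishes_near_iff:
  assumes "E \<subseteq> X \<times> Y"
  shows "vanishes_near X Y E \<Psi> \<longleftrightarrow>
    (\<forall>p\<in>E. \<forall>\<^sub>F q in inf (nhds p) (principal (X \<times> Y)). \<Psi> q = 0)"
proof
  assume "vanishes_near X Y E \<Psi>"
  then obtain T where T: "open T" "E \<subseteq> X \<times> Y \<inter> T" "\<forall>p\<in>X \<times> Y \<inter> T. \<Psi> p = 0"
    unfolding vanishes_near_open_iff by blast
  then show "\<forall>p\<in>E. \<forall>\<^sub>F q in inf (nhds p) (principal (X \<times> Y)). \<Psi> q = 0"
    unfolding eventually_inf_principal eventually_nhds by blast
next
  assume *: "\<forall>p\<in>E. \<forall>\<^sub>F q in inf (nhds p) (principal (X \<times> Y)). \<Psi> q = 0"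
  define T where "T = \<Union>{S. open S \<and> (\<forall>q\<in>X \<times> Y \<inter> S. \<Psi> q = 0)}"
  have "open T" unfolding T_def by (intro open_Union) auto
  moreover have "E \<subseteq> X \<times> Y \<inter> T"
  proof
    fix p assume p: "p \<in> E"
    then obtain S where "open S" "p \<in> S" "\<forall>q\<in>S. q \<in> X \<times> Y \<longrightarrow> \<Psi> q = 0"
      using * unfolding eventually_inf_principal eventually_nhds by meson
    then show "p \<in> X \<times> Y \<inter> T" using p assms by (auto simp: T_def)
  qed
  moreover have "\<forall>p\<in>X \<times> Y \<inter> T. \<Psi> p = 0"
    unfolding T_def by blast
  ultimately show "vanishes_near X Y E \<Psi>"
    unfolding vanishes_near_open_iff by blast
qed

lemma vanishes_near_subset: "vanishes_near X Y E \<Psi> \<Longrightarrow> F \<subseteq> E \<Longrightarrow> vanishes_near X Y F \<Psi>"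
  unfolding vanishes_near_def by blast

lemma eventually_in_open_preimage:
  assumes "continuous_on S f" "p \<in> S" "open T" "f p \<in> T"
  shows "\<forall>\<^sub>F q in inf (nhds p) (principal S). f q \<in> T"
  using assms unfolding continuous_on_topological eventually_inf_principal eventually_nhds by metis

text \<open>
  Synthesis of all intersections with closed rectangles, in a form suited to induction: the
  approximating functions vanish near a subset of \<open>X \<times> Y\<close>, and the error is measured on all of
  \<open>X \<times> Y\<close>.
\<close>

definition rectangle_synthetic ::
  "'a::metric_space set \<Rightarrow> 'b::metric_space set \<Rightarrow> ('a \<times> 'b) set \<Rightarrow> bool" where
  "rectangle_synthetic X Y E \<longleftrightarrow> compact E \<and> E \<subseteq> X \<times> Y \<and>
     (\<forall>A B \<Phi> r \<epsilon>. compact A \<longrightarrow> A \<subseteq> X \<longrightarrow> compact B \<longrightarrow> B \<subseteq> Y \<longrightarrow> tensor_bound X Y r \<Phi> \<longrightarrow>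
        (\<forall>p\<in>E \<inter> A \<times> B. \<Phi> p = 0) \<longrightarrow> 0 < \<epsilon> \<longrightarrow>
        (\<exists>\<Psi>. vanishes_near X Y (E \<inter> A \<times> B) \<Psi> \<and> tensor_bound X Y \<epsilon> (\<lambda>p. \<Phi> p - \<Psi> p)))"

lemma rectangle_syntheticD:
  assumes "rectangle_synthetic X Y E" "compact A" "A \<subseteq> X" "compact B" "B \<subseteq> Y"
    "tensor_bound X Y r \<Phi>" "\<And>x y. (x, y) \<in> E \<Longrightarrow> x \<in> A \<Longrightarrow> y \<in> B \<Longrightarrow> \<Phi> (x, y) = 0" "0 < \<epsilon>"
  shows "\<exists>\<Psi>. vanishes_near X Y (E \<inter> A \<times> B) \<Psi> \<and> tensor_bound X Y \<epsilon> (\<lambda>p. \<Phi> p - \<Psi> p)"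
proof -
  have "\<forall>p\<in>E \<inter> A \<times> B. \<Phi> p = 0" using assms(7) by auto
  then show ?thesis using assms unfolding rectangle_synthetic_def by blast
qed

lemma compact_preimage_closed:
  assumes "compact K" "continuous_on K f" "closed S"
  shows "compact {x\<in>K. f x \<in> S}"
proof -
  have "closedin (top_of_set K) (K \<inter> f -` S)"
    using assms by (intro continuous_closedin_preimage) auto
  then have "compact (K \<inter> f -` S)" using closedin_compact assms(1) by blast
  moreover have "K \<inter> f -` S = {x\<in>K. f x \<in> S}" by auto
  ultimately show ?thesis by simp
qed

text \<open>
  The rectangle \<open>{\<phi> = z} \<times> {\<psi> = z}\<close> is a decreasing intersection of neighbourhoods, so a function
  vanishing near \<open>E\<close> on the rectangle also does so on one of these neighbourhoods, by compactness.
\<close>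

lemma fibre_synthesis_neighbourhood:
  fixes \<phi> :: "'a::metric_space \<Rightarrow> 'c::metric_space" and \<psi> :: "'b::metric_space \<Rightarrow> 'c"
  assumes E: "rectangle_synthetic X Y E" and A: "compact A" "A \<subseteq> X" and B: "compact B" "B \<subseteq> Y"
    and cont: "continuous_on X \<phi>" "continuous_on Y \<psi>"
    and \<Phi>: "tensor_bound X Y r \<Phi>"
      "\<And>x y. (x, y) \<in> E \<Longrightarrow> x \<in> A \<Longrightarrow> y \<in> B \<Longrightarrow> \<phi> x = z \<Longrightarrow> \<psi> y = z \<Longrightarrow> \<Phi> (x, y) = 0"
    and \<epsilon>: "0 < \<epsilon>"
  shows "\<exists>\<Psi> c. 0 < c \<and> tensor_bound X Y \<epsilon> (\<lambda>p. \<Phi> p - \<Psi> p) \<and>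
    vanishes_near X Y (E \<inter> {x\<in>A. dist (\<phi> x) z < c} \<times> {y\<in>B. dist (\<psi> y) z < c}) \<Psi>"
proof -
  have fib: "compact {x\<in>K. f x = z}" if "compact K" "continuous_on K f"
    for K :: "'d::metric_space set" and f :: "'d \<Rightarrow> 'c"
    using compact_preimage_closed[OF that closed_singleton[of z]] by simp
  have EXY: "compact E" "E \<subseteq> X \<times> Y" using E by (auto simp: rectangle_synthetic_def)
  obtain \<Psi> where \<Psi>: "vanishes_near X Y (E \<inter> {x\<in>A. \<phi> x = z} \<times> {y\<in>B. \<psi> y = z}) \<Psi>"
    "tensor_bound X Y \<epsilon> (\<lambda>p. \<Phi> p - \<Psi> p)"
  proof -
    have "{x\<in>A. \<phi> x = z} \<subseteq> X" "{y\<in>B. \<psi> y = z} \<subseteq> Y" using A B by auto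
    then have "\<exists>\<Psi>. vanishes_near X Y (E \<inter> {x\<in>A. \<phi> x = z} \<times> {y\<in>B. \<psi> y = z}) \<Psi> \<and>
        tensor_bound X Y \<epsilon> (\<lambda>p. \<Phi> p - \<Psi> p)"
      by (rule rectangle_syntheticD[OF E fib[OF A(1) continuous_on_subset[OF cont(1) A(2)]] _
            fib[OF B(1) continuous_on_subset[OF cont(2) B(2)]] _ \<Phi>(1) _ \<epsilon>])
        (auto intro: \<Phi>(2))
    then show ?thesis using that by blast
  qed
  then obtain T where T: "open T" "E \<inter> {x\<in>A. \<phi> x = z} \<times> {y\<in>B. \<psi> y = z} \<subseteq> X \<times> Y \<inter> T"
    "\<forall>p\<in>X \<times> Y \<inter> T. \<Psi> p = 0"
    unfolding vanishes_near_open_iff by blast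
  define K where "K = E \<inter> A \<times> B - T"
  define m where "m p = max (dist (\<phi> (fst p)) z) (dist (\<psi> (snd p)) z)" for p
  have K: "compact K"
    unfolding K_def using EXY A B T by (intro compact_diff compact_Int compact_Times)
  have m: "continuous_on K m"
    unfolding m_def using EXY(2)
    by (intro continuous_intros continuous_on_compose2[OF cont(1)] continuous_on_compose2[OF cont(2)])
      (auto simp: K_def)
  have mpos: "0 < m p" if "p \<in> K" for p
  proof (rule ccontr)
    assume "\<not> 0 < m p"
    then have "\<phi> (fst p) = z" "\<psi> (snd p) = z" by (auto simp: m_def not_less)
    then have "p \<in> E \<inter> {x\<in>A. \<phi> x = z} \<times> {y\<in>B. \<psi> y = z}"
      using that by (auto simp: K_def)
    then show False using T(2) that by (auto simp: K_def)
  qed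
  have "\<exists>c>0. \<forall>p\<in>K. c \<le> m p"
  proof (cases "K = {}")
    case False
    then obtain p where "p \<in> K" "\<forall>q\<in>K. m p \<le> m q"
      using continuous_attains_inf[OF K False m] by blast
    then show ?thesis using mpos by blast
  qed (auto intro: exI[of _ 1])
  then obtain c where c: "0 < c" "\<And>p. p \<in> K \<Longrightarrow> c \<le> m p" by blast
  have "E \<inter> {x\<in>A. dist (\<phi> x) z < c} \<times> {y\<in>B. dist (\<psi> y) z < c} \<subseteq> X \<times> Y \<inter> T"
  proof
    fix p assume p: "p \<in> E \<inter> {x\<in>A. dist (\<phi> x) z < c} \<times> {y\<in>B. dist (\<psi> y) z < c}"
    then have "m p < c" by (auto simp: m_def)
    then have "p \<notin> K" using c(2)[of p] by auto
    then show "p \<in> X \<times> Y \<inter> T" using p EXY(2) by (auto simp: K_def)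
  qed
  then have "vanishes_near X Y (E \<inter> {x\<in>A. dist (\<phi> x) z < c} \<times> {y\<in>B. dist (\<psi> y) z < c}) \<Psi>"
    unfolding vanishes_near_open_iff using T(1,3) by blast
  then show ?thesis using c(1) \<Psi>(2) by blast
qed

section \<open>Cutting the product into a grid\<close>

text \<open>
  The piecewise linear bump on \<open>{j..j + 2}\<close> with peak value one at \<open>j + 1\<close>, written as a difference
  of two ramps so that sums telescope.
\<close>

definition tent :: "nat \<Rightarrow> real \<Rightarrow> real" where
  "tent j u = max 0 (min 1 (u - real j)) - max 0 (min 1 (u - real (Suc j)))"

lemma tent_nonneg: "0 \<le> tent j u"
  by (auto simp: tent_def)

lemma tent_eq_0: "u < real j \<or> real j + 2 < u \<Longrightarrow> tent j u = 0"
  by (auto simp: tent_def)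

lemma continuous_on_tent: "continuous_on S f \<Longrightarrow> continuous_on S (\<lambda>x. tent j (f x))"
  unfolding tent_def by (intro continuous_intros)

lemma sum_tent:
  assumes "1 \<le> u" "u \<le> real n"
  shows "(\<Sum>j<n. tent j u) = 1"
proof -
  have "(\<Sum>j<n. tent j u) = max 0 (min 1 (u - real 0)) - max 0 (min 1 (u - real n))"
    unfolding tent_def by (rule sum_lessThan_telescope')
  then show ?thesis using assms by simp
qed

text \<open>
  A set of cells that meets each row and each column of the grid at most once is block-diagonal after
  relabelling.
\<close>

lemma tensor_bound_matching_cells:
  fixes \<alpha> :: "'a::metric_space \<Rightarrow> real" and \<beta> :: "'b::metric_space \<Rightarrow> real"
  assumes cont: "continuous_on X \<alpha>" "continuous_on Y \<beta>"
    and range: "\<And>x. x \<in> X \<Longrightarrow> 1 \<le> \<alpha> x \<and> \<alpha> x \<le> real n" "\<And>y. y \<in> Y \<Longrightarrow> 1 \<le> \<beta> y \<and> \<beta> y \<le> real n"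
    and J: "J \<subseteq> {..<n} \<times> {..<n}" "inj_on fst J" "inj_on snd J"
    and R: "\<And>j k. (j, k) \<in> J \<Longrightarrow> tensor_bound X Y r (R (j, k))" and r: "0 \<le> r"
  shows "tensor_bound X Y r (\<lambda>(x, y). \<Sum>p\<in>J.
    of_real (tent (fst p) (\<alpha> x)) * of_real (tent (snd p) (\<beta> y)) * R p (x, y))"
proof (rule tensor_bound_block_diagonal)
  show fin: "finite J" using J(1) by (rule finite_subset) auto
  have le: "(\<Sum>p\<in>J. tent (\<pi> p) u) \<le> 1"
    if "inj_on \<pi> J" "\<pi> ` J \<subseteq> {..<n}" "1 \<le> u \<and> u \<le> real n" for \<pi> and u
  proof -
    have "(\<Sum>p\<in>J. tent (\<pi> p) u) = (\<Sum>j\<in>\<pi> ` J. tent j u)"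
      using that(1) by (simp add: sum.reindex)
    also have "\<dots> \<le> (\<Sum>j<n. tent j u)"
      using that(2) by (intro sum_mono2) (auto simp: tent_nonneg)
    finally show ?thesis using sum_tent that(3) by simp
  qed
  have Jn: "fst ` J \<subseteq> {..<n}" "snd ` J \<subseteq> {..<n}" using J(1) by auto
  show "(\<Sum>p\<in>J. norm (complex_of_real (tent (fst p) (\<alpha> x)))) \<le> 1" if "x \<in> X" for x
    using le[OF J(2) Jn(1) range(1)[OF that]] by (simp add: tent_nonneg)
  show "(\<Sum>p\<in>J. norm (complex_of_real (tent (snd p) (\<beta> y)))) \<le> 1" if "y \<in> Y" for y
    using le[OF J(3) Jn(2) range(2)[OF that]] by (simp add: tent_nonneg)
  show "continuous_on X (\<lambda>x. complex_of_real (tent (fst p) (\<alpha> x)))" for p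
    using cont by (intro continuous_on_of_real continuous_on_tent)
  show "continuous_on Y (\<lambda>y. complex_of_real (tent (snd p) (\<beta> y)))" for p
    using cont by (intro continuous_on_of_real continuous_on_tent)
  show "tensor_bound X Y r (R p)" if "p \<in> J" for p
    using R[of "fst p" "snd p"] that by simp
qed (rule r)

text \<open>
  Split the grid into the diagonals \<open>k - j = d\<close>. Each of the five with \<open>\<bar>d\<bar> \<le> 2\<close> contributes at most
  \<open>\<epsilon>\<close>, and the at most \<open>2 * n + 1\<close> others together contribute at most \<open>\<epsilon>\<close>.
\<close>

lemma tensor_bound_grid:
  fixes \<alpha> :: "'a::metric_space \<Rightarrow> real" and \<beta> :: "'b::metric_space \<Rightarrow> real"
  assumes cont: "continuous_on X \<alpha>" "continuous_on Y \<beta>"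
    and range: "\<And>x. x \<in> X \<Longrightarrow> 1 \<le> \<alpha> x \<and> \<alpha> x \<le> real n" "\<And>y. y \<in> Y \<Longrightarrow> 1 \<le> \<beta> y \<and> \<beta> y \<le> real n"
    and \<epsilon>: "0 \<le> \<epsilon>"
    and near: "\<And>j k. j < n \<Longrightarrow> k < n \<Longrightarrow> tensor_bound X Y \<epsilon> (R (j, k))"
    and far: "\<And>j k. j < n \<Longrightarrow> k < n \<Longrightarrow> 2 < \<bar>int k - int j\<bar> \<Longrightarrow> tensor_bound X Y (\<epsilon> / real (2 * n + 1)) (R (j, k))"
  shows "tensor_bound X Y (6 * \<epsilon>) (\<lambda>(x, y). \<Sum>p\<in>{..<n} \<times> {..<n}.
    of_real (tent (fst p) (\<alpha> x)) * of_real (tent (snd p) (\<beta> y)) * R p (x, y))"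
proof -
  define I where "I = {..<n} \<times> {..<n}"
  define J where "J d = {p \<in> I. int (snd p) - int (fst p) = d}" for d
  define D where "D = {- int n..int n}"
  define \<eta> where "\<eta> d = (if \<bar>d\<bar> \<le> 2 then \<epsilon> else \<epsilon> / real (2 * n + 1))" for d :: int
  let ?t = "\<lambda>p x y. complex_of_real (tent (fst p) (\<alpha> x)) * of_real (tent (snd p) (\<beta> y)) * R p (x, y)"
  have "tensor_bound X Y (\<eta> d) (\<lambda>(x, y). \<Sum>p\<in>J d. ?t p x y)" for d
  proof (rule tensor_bound_matching_cells[OF cont range])
    show "J d \<subseteq> {..<n} \<times> {..<n}" by (auto simp: J_def I_def)
    show "inj_on fst (J d)" "inj_on snd (J d)"
      by (auto simp: inj_on_def J_def)
    show "tensor_bound X Y (\<eta> d) (R (j, k))" if "(j, k) \<in> J d" for j k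
      using that near[of j k] far[of j k] by (auto simp: J_def I_def \<eta>_def)
    show "0 \<le> \<eta> d" using \<epsilon> by (simp add: \<eta>_def)
  qed auto
  from tensor_bound_sum[of D X Y \<eta>, OF _ this]
  have "tensor_bound X Y (\<Sum>d\<in>D. \<eta> d) (\<lambda>q. \<Sum>d\<in>D. case q of (x, y) \<Rightarrow> \<Sum>p\<in>J d. ?t p x y)"
    by (simp add: D_def)
  moreover have "(\<Sum>d\<in>D. \<eta> d) \<le> 6 * \<epsilon>"
  proof -
    have "(\<Sum>d\<in>D. \<eta> d) \<le> (\<Sum>d\<in>D. (if d \<in> {-2..2} then \<epsilon> else 0) + \<epsilon> / real (2 * n + 1))"
      using \<epsilon> by (intro sum_mono) (auto simp: \<eta>_def)
    also have "\<dots> = (\<Sum>d\<in>D \<inter> {-2..2}. \<epsilon>) + real (card D) * (\<epsilon> / real (2 * n + 1))"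
    proof -
      have "(\<Sum>d\<in>D. if d \<in> {-2..2} then \<epsilon> else 0) = (\<Sum>d\<in>D \<inter> {-2..2}. \<epsilon>)"
        by (rule sum.inter_restrict[symmetric]) (simp add: D_def)
      then show ?thesis by (simp only: sum.distrib sum_constant)
    qed
    also have "real (card D) * (\<epsilon> / real (2 * n + 1)) = \<epsilon>"
      by (simp add: D_def field_simps)
    also have "(\<Sum>d\<in>D \<inter> {-2..2}. \<epsilon>) \<le> (\<Sum>d\<in>{-2..2::int}. \<epsilon>)"
      using \<epsilon> by (intro sum_mono2) auto
    finally show ?thesis by simp
  qed
  ultimately have "tensor_bound X Y (6 * \<epsilon>) (\<lambda>q. \<Sum>d\<in>D. case q of (x, y) \<Rightarrow> \<Sum>p\<in>J d. ?t p x y)"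
    by (rule tensor_bound_mono)
  then show ?thesis
  proof (rule tensor_bound_cong)
    fix x y
    have "(\<Sum>d\<in>D. \<Sum>p\<in>J d. ?t p x y) = (\<Sum>p\<in>I. ?t p x y)"
      unfolding J_def by (rule sum.group) (auto simp: I_def D_def)
    then show "(\<Sum>d\<in>D. case (x, y) of (x, y) \<Rightarrow> \<Sum>p\<in>J d. ?t p x y) =
        (case (x, y) of (x, y) \<Rightarrow> \<Sum>p\<in>{..<n} \<times> {..<n}. ?t p x y)"
      by (simp add: I_def)
  qed
qed

section \<open>Adding one inequality\<close>

text \<open>
  In the proof, \<open>\<alpha> = h \<circ> \<phi>\<close> and \<open>\<beta> = h \<circ> \<psi>\<close> for a monotone real function \<open>h\<close> on \<open>Z\<close> such that each
  stretch on which \<open>h\<close> varies by less than six fits into one of the fibre neighbourhoods. As \<open>h\<close> need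
  not be injective, \<open>h s < h t\<close> implies \<open>s < t\<close> but \<open>h s = h t\<close> says nothing about the order; this is
  why the cells treated as near the diagonal include those with \<open>\<bar>j - k\<bar> = 2\<close>, leaving a gap between
  the values of \<open>\<alpha>\<close> and \<open>\<beta>\<close> on all other cells. The cell \<open>(j, k)\<close> is
  \<open>{j \<le> \<alpha> \<le> j + 2} \<times> {k \<le> \<beta> \<le> k + 2}\<close>, and for \<open>\<bar>j - k\<bar> \<le> 2\<close> it lies in
  \<open>{\<bar>\<alpha> - u\<bar> \<le> 2} \<times> {\<bar>\<beta> - u\<bar> \<le> 2}\<close> with \<open>u = min j k + 2\<close>.
\<close>

lemma rectangle_synthetic_Int_le:
  fixes \<phi> :: "'a::metric_space \<Rightarrow> 'c::{metric_space, linorder_topology}"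
    and \<psi> :: "'b::metric_space \<Rightarrow> 'c"
  assumes E: "rectangle_synthetic X Y E"
    and XYZ: "compact X" "compact Y" "compact Z"
    and \<phi>: "continuous_on X \<phi>" "\<phi> ` X \<subseteq> Z" and \<psi>: "continuous_on Y \<psi>" "\<psi> ` Y \<subseteq> Z"
  shows "rectangle_synthetic X Y (E \<inter> {(x, y). \<phi> x \<le> \<psi> y})"
  unfolding rectangle_synthetic_def
proof (intro conjI allI impI)
  have EXY: "compact E" "E \<subseteq> X \<times> Y" using E by (auto simp: rectangle_synthetic_def)
  then show "E \<inter> {(x, y). \<phi> x \<le> \<psi> y} \<subseteq> X \<times> Y" by blast
  show "compact (E \<inter> {(x, y). \<phi> x \<le> \<psi> y})"
  proof -
    have "continuous_on E (\<lambda>p. (\<phi> (fst p), \<psi> (snd p)))"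
      using EXY(2) by (intro continuous_intros continuous_on_compose2[OF \<phi>(1)]
          continuous_on_compose2[OF \<psi>(1)]) auto
    then have "closedin (top_of_set E) (E \<inter> (\<lambda>p. (\<phi> (fst p), \<psi> (snd p))) -` {(a, b) | a b. a \<le> b})"
      by (intro continuous_closedin_preimage closed_subdiagonal)
    then have "compact (E \<inter> (\<lambda>p. (\<phi> (fst p), \<psi> (snd p))) -` {(a, b) | a b. a \<le> b})"
      using closedin_compact EXY(1) by blast
    moreover have "E \<inter> (\<lambda>p. (\<phi> (fst p), \<psi> (snd p))) -` {(a, b) | a b. a \<le> b} =
        E \<inter> {(x, y). \<phi> x \<le> \<psi> y}" by auto
    ultimately show ?thesis by simp
  qed
  fix A B \<Phi> r and \<epsilon> :: real
  assume A: "compact A" "A \<subseteq> X" and B: "compact B" "B \<subseteq> Y" and \<Phi>: "tensor_bound X Y r \<Phi>"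
    and zero: "\<forall>p\<in>E \<inter> {(x, y). \<phi> x \<le> \<psi> y} \<inter> A \<times> B. \<Phi> p = 0" and \<epsilon>: "0 < \<epsilon>"
  define \<delta> where "\<delta> = \<epsilon> / 6"
  have \<delta>: "0 < \<delta>" using \<epsilon> by (simp add: \<delta>_def)
  have zero': "\<Phi> (x, y) = 0" if "(x, y) \<in> E" "x \<in> A" "y \<in> B" "\<phi> x \<le> \<psi> y" for x y
    using zero that by blast
  have \<phi>Z: "\<phi> x \<in> Z" if "x \<in> X" for x using \<phi>(2) that by blast
  have \<psi>Z: "\<psi> y \<in> Z" if "y \<in> Y" for y using \<psi>(2) that by blast
  define fits where "fits z \<Psi> c \<longleftrightarrow> 0 < c \<and> tensor_bound X Y \<delta> (\<lambda>p. \<Phi> p - \<Psi> p) \<and>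
    vanishes_near X Y (E \<inter> {x\<in>A. dist (\<phi> x) z < c} \<times> {y\<in>B. dist (\<psi> y) z < c}) \<Psi>" for z \<Psi> c
  have "\<exists>p. fits z (fst p) (snd p)" for z
    using fibre_synthesis_neighbourhood[OF E A B \<phi>(1) \<psi>(1) \<Phi>(1), of z \<delta>] zero' \<delta>
    unfolding fits_def by force
  then obtain Q where Q: "\<And>z. fits z (fst (Q z)) (snd (Q z))" by metis
  have "\<exists>h. continuous_on Z h \<and> mono_on Z h \<and>
      (\<forall>s\<in>Z. \<exists>z\<in>Z. \<forall>t\<in>Z. \<bar>h s - h t\<bar> < (6::real) \<longrightarrow> t \<in> ball z (snd (Q z)))"
    by (rule monotone_lebesgue_number[OF XYZ(3)]) (use Q in \<open>auto simp: fits_def\<close>)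
  then obtain h0 :: "'c \<Rightarrow> real" where h0: "continuous_on Z h0" "mono_on Z h0"
    "\<And>s. s \<in> Z \<Longrightarrow> \<exists>z\<in>Z. \<forall>t\<in>Z. \<bar>h0 s - h0 t\<bar> < 6 \<longrightarrow> t \<in> ball z (snd (Q z))"
    by blast
  obtain M where M: "\<And>z. z \<in> Z \<Longrightarrow> \<bar>h0 z\<bar> \<le> M"
    using compact_imp_bounded[OF compact_continuous_image[OF h0(1) XYZ(3)]]
    by (auto simp: bounded_iff)
  \<comment> \<open>The shift puts the values of \<open>h\<close> into \<open>{1..n}\<close>, where the first \<open>n\<close> tents sum to one.\<close>
  define h where "h z = h0 z + M + 1" for z
  have h: "continuous_on Z h" "\<And>s t. s \<in> Z \<Longrightarrow> t \<in> Z \<Longrightarrow> s \<le> t \<Longrightarrow> h s \<le> h t" "\<And>z. z \<in> Z \<Longrightarrow> 1 \<le> h z"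
    "\<And>s. s \<in> Z \<Longrightarrow> \<exists>z\<in>Z. \<forall>t\<in>Z. \<bar>h s - h t\<bar> < 6 \<longrightarrow> t \<in> ball z (snd (Q z))"
  proof -
    show "continuous_on Z h" unfolding h_def using h0(1) by (intro continuous_intros)
    show "h s \<le> h t" if "s \<in> Z" "t \<in> Z" "s \<le> t" for s t
      using mono_onD[OF h0(2) that] by (simp add: h_def)
    show "1 \<le> h z" if "z \<in> Z" for z using M[OF that] by (simp add: h_def)
  qed (use h0(3) in \<open>simp add: h_def\<close>)
  define n where "n = nat \<lceil>2 * M + 1\<rceil>"
  have hn: "h z \<le> real n" if "z \<in> Z" for z
    using M[OF that] unfolding h_def n_def by linarith
  define \<alpha> \<beta> where "\<alpha> x = h (\<phi> x)" and "\<beta> y = h (\<psi> y)" for x y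
  have cont: "continuous_on X \<alpha>" "continuous_on Y \<beta>"
    unfolding \<alpha>_def \<beta>_def using \<phi> \<psi> by (auto intro!: continuous_on_compose2[OF h(1)])
  have range: "x \<in> X \<Longrightarrow> 1 \<le> \<alpha> x \<and> \<alpha> x \<le> real n" "y \<in> Y \<Longrightarrow> 1 \<le> \<beta> y \<and> \<beta> y \<le> real n" for x y
    using h(3) hn \<phi>Z \<psi>Z by (auto simp: \<alpha>_def \<beta>_def)

  have "\<exists>\<Psi>. tensor_bound X Y \<delta> (\<lambda>p. \<Phi> p - \<Psi> p) \<and>
      vanishes_near X Y (E \<inter> {x\<in>A. \<bar>\<alpha> x - u\<bar> < 3} \<times> {y\<in>B. \<bar>\<beta> y - u\<bar> < 3}) \<Psi>" for u
  proof (cases "\<exists>s\<in>Z. \<bar>h s - u\<bar> < 3")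
    case True
    then obtain s where s: "s \<in> Z" "\<bar>h s - u\<bar> < 3" by blast
    then obtain z where z: "z \<in> Z" "\<And>t. t \<in> Z \<Longrightarrow> \<bar>h s - h t\<bar> < 6 \<Longrightarrow> t \<in> ball z (snd (Q z))"
      using h(4) by blast
    have *: "dist t z < snd (Q z)" if "t \<in> Z" "\<bar>h t - u\<bar> < 3" for t
      using z(2)[OF that(1)] that(2) s(2) by (simp add: dist_commute)
    have "E \<inter> {x\<in>A. \<bar>\<alpha> x - u\<bar> < 3} \<times> {y\<in>B. \<bar>\<beta> y - u\<bar> < 3} \<subseteq>
        E \<inter> {x\<in>A. dist (\<phi> x) z < snd (Q z)} \<times> {y\<in>B. dist (\<psi> y) z < snd (Q z)}"
      using * \<phi>Z \<psi>Z A(2) B(2) by (auto simp: \<alpha>_def \<beta>_def)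
    then show ?thesis
      using Q[of z] vanishes_near_subset unfolding fits_def by blast
  next
    case False
    have "E \<inter> {x\<in>A. \<bar>\<alpha> x - u\<bar> < 3} \<times> {y\<in>B. \<bar>\<beta> y - u\<bar> < 3} = {}"
      using False \<phi>Z A(2) by (auto simp: \<alpha>_def)
    then have "vanishes_near X Y (E \<inter> {x\<in>A. \<bar>\<alpha> x - u\<bar> < 3} \<times> {y\<in>B. \<bar>\<beta> y - u\<bar> < 3}) \<Phi>"
      by (simp add: vanishes_near_iff)
    then show ?thesis
      using tensor_bound_zero[of \<delta> X Y] \<delta> by (intro exI[of _ \<Phi>]) simp
  qed
  from choice[OF allI, OF this] obtain Near where "\<forall>u. tensor_bound X Y \<delta> (\<lambda>p. \<Phi> p - Near u p) \<and>
    vanishes_near X Y (E \<inter> {x\<in>A. \<bar>\<alpha> x - u\<bar> < 3} \<times> {y\<in>B. \<bar>\<beta> y - u\<bar> < 3}) (Near u)" ..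
  then have Near: "\<And>u. tensor_bound X Y \<delta> (\<lambda>p. \<Phi> p - Near u p)"
    "\<And>u. vanishes_near X Y (E \<inter> {x\<in>A. \<bar>\<alpha> x - u\<bar> < 3} \<times> {y\<in>B. \<bar>\<beta> y - u\<bar> < 3}) (Near u)"
    by auto

  have "\<exists>\<Psi>. vanishes_near X Y (E \<inter> {x\<in>A. \<alpha> x \<in> {..u}} \<times> {y\<in>B. \<beta> y \<in> {v..}}) \<Psi> \<and>
      tensor_bound X Y (\<delta> / real (2 * n + 1)) (\<lambda>p. \<Phi> p - \<Psi> p)" if "u < v" for u v
  proof (rule rectangle_syntheticD[OF E _ _ _ _ \<Phi>])
    show "compact {x\<in>A. \<alpha> x \<in> {..u}}" "compact {y\<in>B. \<beta> y \<in> {v..}}"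
      by (rule compact_preimage_closed[OF A(1) continuous_on_subset[OF cont(1) A(2)] closed_atMost],
          rule compact_preimage_closed[OF B(1) continuous_on_subset[OF cont(2) B(2)] closed_atLeast])
    show "{x\<in>A. \<alpha> x \<in> {..u}} \<subseteq> X" "{y\<in>B. \<beta> y \<in> {v..}} \<subseteq> Y" using A B by auto
    show "0 < \<delta> / real (2 * n + 1)" using \<delta> by simp
    fix x y assume xy: "(x, y) \<in> E" "x \<in> {x\<in>A. \<alpha> x \<in> {..u}}" "y \<in> {y\<in>B. \<beta> y \<in> {v..}}"
    then have "h (\<phi> x) < h (\<psi> y)" using that by (simp add: \<alpha>_def \<beta>_def)
    then have "\<not> \<psi> y \<le> \<phi> x"
      using h(2)[of "\<psi> y" "\<phi> x"] \<phi>Z \<psi>Z A(2) B(2) xy by force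
    then show "\<Phi> (x, y) = 0"
      using zero'[of x y] xy linear by blast
  qed
  then have "\<forall>w. \<exists>\<Psi>. fst w < snd w \<longrightarrow>
      vanishes_near X Y (E \<inter> {x\<in>A. \<alpha> x \<in> {..fst w}} \<times> {y\<in>B. \<beta> y \<in> {snd w..}}) \<Psi> \<and>
      tensor_bound X Y (\<delta> / real (2 * n + 1)) (\<lambda>p. \<Phi> p - \<Psi> p)"
    by blast
  from choice[OF this] obtain U where U: "\<forall>w. fst w < snd w \<longrightarrow>
      vanishes_near X Y (E \<inter> {x\<in>A. \<alpha> x \<in> {..fst w}} \<times> {y\<in>B. \<beta> y \<in> {snd w..}}) (U w) \<and>
      tensor_bound X Y (\<delta> / real (2 * n + 1)) (\<lambda>p. \<Phi> p - U w p)" ..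
  define Up where "Up u v = U (u, v)" for u v
  have Up:
    "\<And>u v. u < v \<Longrightarrow> vanishes_near X Y (E \<inter> {x\<in>A. \<alpha> x \<in> {..u}} \<times> {y\<in>B. \<beta> y \<in> {v..}}) (Up u v)"
    "\<And>u v. u < v \<Longrightarrow> tensor_bound X Y (\<delta> / real (2 * n + 1)) (\<lambda>p. \<Phi> p - Up u v p)"
    using U[rule_format, of "(u, v)" for u v] unfolding Up_def by simp_all

  \<comment> \<open>The replacement for \<open>\<Phi>\<close> on the cell \<open>(j, k)\<close>. Below the diagonal, where \<open>k + 2 < j\<close>, it is \<open>\<Phi>\<close> itself,
    since such cells do not meet \<open>{\<phi> x \<le> \<psi> y}\<close>.\<close>
  define G where "G = (\<lambda>(j::nat, k::nat). if k \<le> j + 2 \<and> j \<le> k + 2 then Near (real (min j k) + 2)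
      else if j + 2 < k then Up (real j + 2) (real k) else \<Phi>)"
  define R where "R = (\<lambda>p q. \<Phi> q - G p q)"
  define a where "a = (\<lambda>p (x, y). complex_of_real (tent (fst p) (\<alpha> x)) * complex_of_real (tent (snd p) (\<beta> y)))"
  define I where "I = {..<n} \<times> {..<n}"
  define \<Theta> where "\<Theta> q = (\<Sum>p\<in>I. a p q * R p q)" for q
  have small: "\<delta> / real (2 * n + 1) \<le> \<delta>" using \<delta> by (simp add: field_simps)
  have far: "tensor_bound X Y (\<delta> / real (2 * n + 1)) (R (j, k))" if "2 < \<bar>int k - int j\<bar>" for j k
  proof (cases "j + 2 < k")
    case True
    then show ?thesis using Up(2)[of "real j + 2" "real k"] by (simp add: R_def G_def)
  next
    case False
    then have "R (j, k) = (\<lambda>p. 0)" using that by (auto simp: R_def G_def)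
    then show ?thesis using tensor_bound_zero[of "\<delta> / real (2 * n + 1)" X Y] \<delta> by simp
  qed
  have near: "tensor_bound X Y \<delta> (R (j, k))" for j k
  proof (cases "2 < \<bar>int k - int j\<bar>")
    case True
    then show ?thesis using far small tensor_bound_mono by blast
  next
    case False
    then have "k \<le> j + 2 \<and> j \<le> k + 2" by linarith
    then show ?thesis using Near(1) by (simp add: R_def G_def)
  qed
  have "tensor_bound X Y (6 * \<delta>) \<Theta>"
  proof (rule tensor_bound_cong)
    show "tensor_bound X Y (6 * \<delta>) (\<lambda>(x, y). \<Sum>p\<in>{..<n} \<times> {..<n}.
        of_real (tent (fst p) (\<alpha> x)) * of_real (tent (snd p) (\<beta> y)) * R p (x, y))"
      by (rule tensor_bound_grid[OF cont range less_imp_le[OF \<delta>]]) (simp_all only: near far)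
  qed (auto simp: \<Theta>_def I_def a_def)
  then have bound: "tensor_bound X Y \<epsilon> (\<lambda>p. \<Phi> p - (\<Phi> p - \<Theta> p))"
    by (simp add: \<delta>_def)
  have partition: "\<Phi> q - \<Theta> q = (\<Sum>p\<in>I. a p q * G p q)" if "q \<in> X \<times> Y" for q
  proof -
    obtain x y where q: "q = (x, y)" "x \<in> X" "y \<in> Y"
      using \<open>q \<in> X \<times> Y\<close> by auto
    have "(\<Sum>p\<in>I. a p q) = (\<Sum>j<n. complex_of_real (tent j (\<alpha> x))) * (\<Sum>k<n. complex_of_real (tent k (\<beta> y)))"
      unfolding I_def q a_def by (simp add: sum_product sum.cartesian_product case_prod_beta')
    also have "\<dots> = 1"
      using range(1)[OF q(2)] range(2)[OF q(3)] by (simp flip: of_real_sum add: sum_tent)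
    finally have "(\<Sum>p\<in>I. a p q * \<Phi> q) = \<Phi> q" by (simp flip: sum_distrib_right)
    then show ?thesis
      by (simp add: \<Theta>_def R_def right_diff_distrib sum_subtractf)
  qed
  \<comment> \<open>Each of the finitely many summands \<open>a * G\<close> vanishes near \<open>p\<close>: either \<open>p\<close> lies off the closed cell and
    the weight \<open>a\<close> vanishes, or \<open>p\<close> lies in it and the replacement \<open>G\<close> vanishes near \<open>E\<close> there.\<close>
  have "\<forall>\<^sub>F q in inf (nhds p) (principal (X \<times> Y)). \<Phi> q - \<Theta> q = 0"
    if p: "p \<in> E \<inter> {(x, y). \<phi> x \<le> \<psi> y} \<inter> A \<times> B" for p
  proof -
    define F where "F = inf (nhds p) (principal (X \<times> Y))"
    obtain x y where xy: "p = (x, y)" "(x, y) \<in> E" "x \<in> A" "y \<in> B" "\<phi> x \<le> \<psi> y" using p by auto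
    have pXY: "p \<in> X \<times> Y" using xy A B by auto
    have \<alpha>\<beta>: "\<alpha> x \<le> \<beta> y"
      unfolding \<alpha>_def \<beta>_def using xy \<phi>Z \<psi>Z A B by (intro h(2)) auto
    have cf: "continuous_on (X \<times> Y) (\<lambda>q. \<alpha> (fst q))" "continuous_on (X \<times> Y) (\<lambda>q. \<beta> (snd q))"
      by (auto intro!: continuous_on_compose2[OF cont(1)] continuous_on_compose2[OF cont(2)] continuous_intros)
    have cell: "\<forall>\<^sub>F q in F. a (j, k) q * G (j, k) q = 0" for j k
    proof (cases "\<alpha> x \<in> {real j..real j + 2} \<and> \<beta> y \<in> {real k..real k + 2}")
      case False
      then consider "\<alpha> x \<in> - {real j..real j + 2}" | "\<beta> y \<in> - {real k..real k + 2}" by auto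
      then have "\<forall>\<^sub>F q in F. a (j, k) q = 0"
      proof cases
        case 1
        have "\<forall>\<^sub>F q in F. \<alpha> (fst q) \<in> - {real j..real j + 2}"
          unfolding F_def using 1 xy(1) by (intro eventually_in_open_preimage[OF cf(1) pXY]) auto
        then show ?thesis
          by eventually_elim (auto simp: a_def case_prod_beta' tent_eq_0 not_le)
      next
        case 2
        have "\<forall>\<^sub>F q in F. \<beta> (snd q) \<in> - {real k..real k + 2}"
          unfolding F_def using 2 xy(1) by (intro eventually_in_open_preimage[OF cf(2) pXY]) auto
        then show ?thesis
          by eventually_elim (auto simp: a_def case_prod_beta' tent_eq_0 not_le)
      qed
      then show ?thesis by eventually_elim simp
    next
      case True
      have "\<forall>\<^sub>F q in F. G (j, k) q = 0"
      proof (cases "k \<le> j + 2 \<and> j \<le> k + 2")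
        case near: True
        define u where "u = real (min j k) + 2"
        have "\<bar>\<alpha> x - u\<bar> < 3" "\<bar>\<beta> y - u\<bar> < 3"
          using True near by (auto simp: u_def)
        then have pin: "p \<in> E \<inter> {x\<in>A. \<bar>\<alpha> x - u\<bar> < 3} \<times> {y\<in>B. \<bar>\<beta> y - u\<bar> < 3}"
          using xy by simp
        have "E \<inter> {x\<in>A. \<bar>\<alpha> x - u\<bar> < 3} \<times> {y\<in>B. \<bar>\<beta> y - u\<bar> < 3} \<subseteq> X \<times> Y" using EXY(2) by blast
        then have "\<forall>\<^sub>F q in F. Near u q = 0"
          using Near(2)[of u] pin unfolding F_def by (simp add: vanishes_near_iff)
        then show ?thesis using near by (simp add: G_def u_def)
      next
        case not_near: False
        have jk: "j + 2 < k" using not_near True \<alpha>\<beta> by auto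
        define u v where "u = real j + 2" and "v = real k"
        have "u < v" using jk by (simp add: u_def v_def)
        have pin: "p \<in> E \<inter> {x\<in>A. \<alpha> x \<in> {..u}} \<times> {y\<in>B. \<beta> y \<in> {v..}}"
          using xy True by (simp add: u_def v_def)
        have "E \<inter> {x\<in>A. \<alpha> x \<in> {..u}} \<times> {y\<in>B. \<beta> y \<in> {v..}} \<subseteq> X \<times> Y" using EXY(2) by blast
        then have "\<forall>\<^sub>F q in F. Up u v q = 0"
          using Up(1)[OF \<open>u < v\<close>] pin unfolding F_def by (simp add: vanishes_near_iff)
        then show ?thesis using jk by (simp add: G_def u_def v_def)
      qed
      then show ?thesis by eventually_elim simp
    qed
    have "\<forall>\<^sub>F q in F. \<forall>p\<in>I. a p q * G p q = 0"
      using cell by (intro eventually_ball_finite) (auto simp: I_def)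
    moreover have "\<forall>\<^sub>F q in F. q \<in> X \<times> Y"
      unfolding F_def by (simp add: eventually_inf_principal)
    ultimately have "\<forall>\<^sub>F q in F. \<Phi> q - \<Theta> q = 0"
      by eventually_elim (auto simp only: partition intro!: sum.neutral)
    then show ?thesis unfolding F_def .
  qed
  moreover have "E \<inter> {(x, y). \<phi> x \<le> \<psi> y} \<inter> A \<times> B \<subseteq> X \<times> Y" using EXY(2) by blast
  ultimately have "vanishes_near X Y (E \<inter> {(x, y). \<phi> x \<le> \<psi> y} \<inter> A \<times> B) (\<lambda>p. \<Phi> p - \<Theta> p)"
    by (simp add: vanishes_near_iff)
  then show "\<exists>\<Psi>. vanishes_near X Y (E \<inter> {(x, y). \<phi> x \<le> \<psi> y} \<inter> A \<times> B) \<Psi> \<and>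
      tensor_bound X Y \<epsilon> (\<lambda>p. \<Phi> p - \<Psi> p)"
    using bound by blast
qed

lemma rectangle_synthetic_whole:
  assumes "compact X" "compact Y"
  shows "rectangle_synthetic X Y (X \<times> Y)"
  unfolding rectangle_synthetic_def
proof (intro conjI allI impI)
  fix A B \<Phi> r and \<epsilon> :: real
  assume AB: "compact A" "A \<subseteq> X" "compact B" "B \<subseteq> Y"
    and \<Phi>: "tensor_bound X Y r \<Phi>" "\<forall>p\<in>X \<times> Y \<inter> A \<times> B. \<Phi> p = 0" and \<epsilon>: "0 < \<epsilon>"
  have eq: "X \<times> Y \<inter> A \<times> B = A \<times> B" using AB by auto
  show "\<exists>\<Psi>. vanishes_near X Y (X \<times> Y \<inter> A \<times> B) \<Psi> \<and> tensor_bound X Y \<epsilon> (\<lambda>p. \<Phi> p - \<Psi> p)"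
    unfolding eq by (rule rectangle_synthesis[OF assms AB \<Phi>(1) _ \<epsilon>]) (use \<Phi>(2) eq in blast)
qed (use assms in \<open>auto intro: compact_Times\<close>)

lemma rectangle_synthetic_imp_spectral_synthesis:
  assumes XY: "compact X" "compact Y" and E: "rectangle_synthetic X Y E"
  shows "spectral_synthesis X Y E"
  unfolding spectral_synthesis_def
proof (intro conjI ballI impI)
  have EXY: "compact E" "E \<subseteq> X \<times> Y" using E by (auto simp: rectangle_synthetic_def)
  show "closedin (top_of_set (X \<times> Y)) E"
    using EXY by (intro closed_subset compact_imp_closed)
  fix \<Phi> assume \<Phi>V: "\<Phi> \<in> varopoulos X Y" and zero: "\<forall>p\<in>E. \<Phi> p = 0"
  obtain r where \<Phi>: "tensor_bound X Y r \<Phi>"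
    using varopoulos_imp_tensor_bound[OF XY \<Phi>V] by blast
  have eq: "E \<inter> X \<times> Y = E" using EXY(2) by blast
  have "\<exists>\<Psi>. vanishes_near X Y E \<Psi> \<and> tensor_bound X Y (inverse (real (Suc k))) (\<lambda>p. \<Phi> p - \<Psi> p)" for k
    using rectangle_syntheticD[OF E XY(1) order_refl XY(2) order_refl \<Phi>] zero unfolding eq by simp
  then obtain \<Psi> where \<Psi>: "\<And>k. vanishes_near X Y E (\<Psi> k)"
    "\<And>k. tensor_bound X Y (inverse (real (Suc k))) (\<lambda>p. \<Phi> p - \<Psi> k p)"
    by metis
  have "\<Psi> k \<in> varopoulos X Y" for k
    using tensor_bound_imp_varopoulos(1)[OF XY tensor_bound_diff[OF \<Phi> \<Psi>(2)[of k]]] by simp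
  moreover have "(\<lambda>k. varopoulos_norm X Y (\<lambda>p. \<Phi> p - \<Psi> k p)) \<longlonglongrightarrow> 0"
    by (rule tendsto_sandwich[OF _ _ tendsto_const LIMSEQ_inverse_real_of_nat])
      (use tensor_bound_imp_varopoulos(2,3)[OF XY \<Psi>(2)] in auto)
  ultimately show "\<exists>\<Psi>. (\<forall>k::nat. \<Psi> k \<in> varopoulos X Y \<and> vanishes_near X Y E (\<Psi> k)) \<and>
      (\<lambda>k. varopoulos_norm X Y (\<lambda>p. \<Phi> p - \<Psi> k p)) \<longlonglongrightarrow> 0"
    using \<Psi>(1) by blast
qed

theorem corollary6p1:
  fixes X :: "'a::metric_space set" and Y :: "'b::metric_space set"
    and Z :: "'c::{metric_space, linorder_topology} set"
    and n :: nat
    and \<phi> :: "nat \<Rightarrow> 'a \<Rightarrow> 'c" and \<psi> :: "nat \<Rightarrow> 'b \<Rightarrow> 'c"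
  assumes "compact X" and "compact Y" and "compact Z"
    and "\<And>i. i \<in> {1..n} \<Longrightarrow> continuous_on X (\<phi> i) \<and> \<phi> i ` X \<subseteq> Z"
    and "\<And>i. i \<in> {1..n} \<Longrightarrow> continuous_on Y (\<psi> i) \<and> \<psi> i ` Y \<subseteq> Z"
  shows "spectral_synthesis X Y {(x, y). x \<in> X \<and> y \<in> Y \<and> (\<forall>i\<in>{1..n}. \<phi> i x \<le> \<psi> i y)}"
proof -
  have "rectangle_synthetic X Y {(x, y). x \<in> X \<and> y \<in> Y \<and> (\<forall>i\<in>{1..m}. \<phi> i x \<le> \<psi> i y)}"
    if "m \<le> n" for m
    using that
  proof (induction m)
    case 0
    have "{(x, y). x \<in> X \<and> y \<in> Y \<and> (\<forall>i\<in>{1..0::nat}. \<phi> i x \<le> \<psi> i y)} = X \<times> Y" by auto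
    then show ?case using rectangle_synthetic_whole[OF assms(1,2)] by simp
  next
    case (Suc m)
    let ?E = "{(x, y). x \<in> X \<and> y \<in> Y \<and> (\<forall>i\<in>{1..m}. \<phi> i x \<le> \<psi> i y)}"
    have "Suc m \<in> {1..n}" using Suc.prems by simp
    then have "rectangle_synthetic X Y (?E \<inter> {(x, y). \<phi> (Suc m) x \<le> \<psi> (Suc m) y})"
      using assms Suc by (intro rectangle_synthetic_Int_le[where Z = Z]) auto
    moreover have "?E \<inter> {(x, y). \<phi> (Suc m) x \<le> \<psi> (Suc m) y} =
        {(x, y). x \<in> X \<and> y \<in> Y \<and> (\<forall>i\<in>{1..Suc m}. \<phi> i x \<le> \<psi> i y)}"
      by (auto simp: atLeastAtMostSuc_conv)
    ultimately show ?case by simp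
  qed
  then show ?thesis
    using rectangle_synthetic_imp_spectral_synthesis[OF assms(1,2)] by blast
qed

end
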